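(* For every $d \geq 3$ there exist positive reals $(\epsilon_n)_{n \geq 3}$ with $\epsilon_n = (1/2)^{o(n)}$ (that is, $\log_2(1/\epsilon_n) = o(n)$ as $n \to \infty$) such that for every $n \geq 3$ the following holds: every finite set $\mathcal{X} \subset \mathbb{R}^d$ in general position with $|\mathcal{X}| \geq ES_3(8n)$ contains a collection of $n$ subsets $X_1, \ldots, X_n \subset \mathcal{X}$ which is in convex position and satisfies $|X_i| \geq \epsilon_n |\mathcal{X}|$ for all $i = 1, \ldots, n$.
   Context: A set $X \subset \mathbb{R}^d$ with $|X| \geq d+1$ is in general position if no $d+1$ points of $X$ lie on a common affine hyperplane. A finite point set is in convex position if its points are the vertices of a convex polytope. $ES_d(n)$ denotes the smallest integer $N$ such that every set of $N$ points in general position in $\mathbb{R}^d$ contains $n$ points in convex position. A collection of sets $X_1, \ldots, X_n \subset \mathbb{R}^d$ is in convex position if for every $i = 1, \ldots, n$ the convex hulls $\mathrm{conv}(X_i)$ and $\mathrm{conv}(\bigcup_{j \neq i} X_j)$ are disjoint. *)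

theory Defs
  imports "HOL-Analysis.Analysis" "HOL-Library.Landau_Symbols"
begin

(* The size condition belongs to the notion: without it every set of at most DIM('a) points
   (three collinear points in dimension 3, say) would vacuously be in general position. *)
definition general_position :: "'a::euclidean_space set \<Rightarrow> bool" where
  "general_position X \<longleftrightarrow>
     (finite X \<longrightarrow> card X \<ge> DIM('a) + 1) \<and>
     \<not> (\<exists>S a b. S \<subseteq> X \<and> card S = DIM('a) + 1 \<and> a \<noteq> 0 \<and> S \<subseteq> {x. a \<bullet> x = b})"

definition convex_position :: "'a::euclidean_space set \<Rightarrow> bool" where
  "convex_position P \<longleftrightarrow> (\<exists>K. polytope K \<and> P = {v. v extreme_point_of K})"

(* The dimension d is the dimension of the type 'a.  Since sets of at most d points are never
   in general position, N ranges over N >= d + 1; otherwise N = 0 would qualify vacuously. *)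
definition ES :: "'a::euclidean_space itself \<Rightarrow> nat \<Rightarrow> nat" where
  "ES _ n = (LEAST N. N \<ge> DIM('a) + 1 \<and>
     (\<forall>X::'a set. finite X \<and> card X = N \<and> general_position X \<longrightarrow>
        (\<exists>P\<subseteq>X. card P = n \<and> convex_position P)))"

definition family_convex_position :: "'i set \<Rightarrow> ('i \<Rightarrow> 'a::euclidean_space set) \<Rightarrow> bool" where
  "family_convex_position I X \<longleftrightarrow>
     (\<forall>i\<in>I. convex hull (X i) \<inter> convex hull (\<Union>j\<in>I - {i}. X j) = {})"

end

theory Submission
  imports "HOL-Library.Ramsey" "HOL-Real_Asymp.Real_Asymp" Defs
begin

text \<open>
  A generic projection reduces everything to \<open>\<real>\<^sup>3\<close>. There, the main point is that for every
  \<open>\<delta> > 0\<close> and large \<open>n\<close>, any \<open>2\<^bsup>\<delta>n\<^esup>\<close> points in general position contain \<open>n\<close> points each of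
  which is cut off from the others by a plane through three points of the set.

  By Ramsey's theorem and a counting argument there are boundedly many clusters, each of them a
  constant fraction of the set, which lie like points on the moment curve with respect to boundedly
  many single points between them. If, in a projection from a single point \<open>q\<close>, the lines through
  two points of a cluster leave all other clusters on one side, then by the cups-caps theorem this
  cluster contributes a convex chain of linear length bulging away from the others (or already \<open>n\<close>
  points bulging towards them), and the chains of different clusters combine. As boundedly many
  clusters, independent of \<open>n\<close>, suffice, it remains to find enough clusters with such a \<open>q\<close>. For a pair
  of points in a cluster, \<open>q\<close> exists unless the direction of the pair lies in the cone spanned by the
  clusters under consideration; whether it does depends only on the signs of the pair with respect
  to two axes through single points, one joining the first point to the right neighbour and one
  joining the left neighbour to the last point. Each such sign is a total order on the cluster, so
  it can be made to agree with another one, or to disagree, on a large part of the cluster. Asking for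
  agreement with unbalanced sizes, either enough clusters succeed at once, or a whole group of
  clusters fails at almost no cost; iterating inside such groups leaves a chain of clusters which
  succeed for the opposite reason.

  The positive fraction version follows by counting: fixing the points that span the planes, the cut
  off points may vary independently within large sets.
\<close>

section \<open>Counting in products\<close>

lemma pigeonhole_cover:
  assumes "finite T" "T \<noteq> {}" "finite S" "\<And>x. x \<in> S \<Longrightarrow> \<exists>t\<in>T. P t x"
  shows "\<exists>t\<in>T. card S \<le> card T * card {x \<in> S. P t x}"
proof -
  obtain f where f: "\<And>x. x \<in> S \<Longrightarrow> f x \<in> T \<and> P (f x) x" using assms(4) by metis
  then obtain t where t: "t \<in> T" "card S \<le> card (f -` {t} \<inter> S) * card T"
    using pigeonhole_card[of f S T] assms(1-3) by auto
  have "card (f -` {t} \<inter> S) \<le> card {x \<in> S. P t x}" using f assms(3) by (intro card_mono) auto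
  then have "card S \<le> card T * card {x \<in> S. P t x}"
    using t(2) by (metis le_trans mult.commute mult_le_mono2)
  then show ?thesis using t(1) by blast
qed

lemma ex_disjoint_subsets:
  assumes "finite X" "m * s \<le> card X"
  shows "\<exists>A. disjoint_family_on A {..<m} \<and> (\<forall>i<m. A i \<subseteq> X \<and> card (A i) = s)"
proof -
  obtain h where h: "bij_betw h {..<card X} X"
    using ex_bij_betw_nat_finite[OF assms(1)] by (auto simp: atLeast0LessThan)
  have block: "{i * s..<Suc i * s} \<subseteq> {..<card X}" if "i < m" for i
  proof -
    have "Suc i * s \<le> m * s" using that by (intro mult_le_mono1) simp
    then show ?thesis using assms(2) by auto
  qed
  have disj: "{i * s..<Suc i * s} \<inter> {j * s..<Suc j * s} = {}" if "i < j" for i j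
  proof -
    have "Suc i * s \<le> j * s" using that by (intro mult_le_mono1) simp
    then show ?thesis by auto
  qed
  let ?A = "\<lambda>i. h ` {i * s..<Suc i * s}"
  have "?A i \<inter> ?A j = {}" if "i < m" "j < m" "i \<noteq> j" for i j
    using that disj[of i j] disj[of j i] block bij_betw_imp_inj_on[OF h]
    by (metis image_empty inj_on_image_Int linorder_neqE_nat inf_commute)
  then have "disjoint_family_on ?A {..<m}" by (simp add: disjoint_family_on_def)
  moreover have "?A i \<subseteq> X \<and> card (?A i) = s" if "i < m" for i
    using block[OF that] h by (auto simp: bij_betw_def card_image inj_on_subset)
  ultimately show ?thesis by blast
qed

lemma inj_on_PiE_disjoint:
  assumes "f \<in> PiE I A" "disjoint_family_on A I"
  shows "inj_on f I"
  using assms unfolding disjoint_family_on_def by (intro inj_onI) (metis PiE_mem disjoint_iff)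

definition fibre_values :: "('i \<Rightarrow> 'a) set \<Rightarrow> 'i set \<Rightarrow> ('i \<Rightarrow> 'a) \<Rightarrow> 'i \<Rightarrow> 'a set" where
  "fibre_values F D g v = (\<lambda>f. f v) ` {f \<in> F. \<forall>i\<in>D. f i = g i}"

lemma fibre_values_subset: "F \<subseteq> Pi I A \<Longrightarrow> v \<in> I \<Longrightarrow> fibre_values F D g v \<subseteq> A v"
  by (auto simp: fibre_values_def)

lemma card_fibre_le_prod_fibre_values:
  assumes "finite V" "F \<subseteq> extensional (D \<union> V)"
  shows "card {f \<in> F. \<forall>i\<in>D. f i = g i} \<le> (\<Prod>v\<in>V. card (fibre_values F D g v))"
proof (cases "finite {f \<in> F. \<forall>i\<in>D. f i = g i}")
  case True
  let ?fibre = "{f \<in> F. \<forall>i\<in>D. f i = g i}"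
  have "card ?fibre \<le> card (PiE V (fibre_values F D g))"
  proof (rule card_inj_on_le[where f = "\<lambda>f. restrict f V"])
    show "inj_on (\<lambda>f. restrict f V) ?fibre"
    proof (intro inj_onI extensionalityI)
      fix f f' assume f: "f \<in> ?fibre" "f' \<in> ?fibre" and eq: "restrict f V = restrict f' V"
      show "f \<in> extensional (D \<union> V)" "f' \<in> extensional (D \<union> V)" using f assms(2) by auto
      fix i assume "i \<in> D \<union> V"
      then show "f i = f' i" using f eq by (auto dest: fun_cong[of _ _ i] split: if_splits)
    qed
    show "(\<lambda>f. restrict f V) ` ?fibre \<subseteq> PiE V (fibre_values F D g)"
      by (auto simp: fibre_values_def)
    show "finite (PiE V (fibre_values F D g))"
      using assms(1) True by (intro finite_PiE) (auto simp: fibre_values_def)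
  qed
  then show ?thesis using assms(1) by (simp add: card_PiE)
qed simp

lemma ex_large_fibre:
  assumes "finite D" "\<And>i. i \<in> D \<Longrightarrow> finite (A i) \<and> A i \<noteq> {}" "finite F" "F \<subseteq> Pi D A"
  shows "\<exists>g\<in>PiE D A. card F \<le> (\<Prod>i\<in>D. card (A i)) * card {f \<in> F. \<forall>i\<in>D. f i = g i}"
proof -
  have "\<exists>g\<in>PiE D A. card F \<le> card (PiE D A) * card {f \<in> F. \<forall>i\<in>D. f i = g i}"
  proof (rule pigeonhole_cover)
    show "finite (PiE D A)" "PiE D A \<noteq> {}"
      using assms by (auto intro: finite_PiE simp: PiE_eq_empty_iff)
    show "\<exists>g\<in>PiE D A. \<forall>i\<in>D. f i = g i" if "f \<in> F" for f
      using assms(4) that by (intro bexI[of _ "restrict f D"]) auto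
  qed (fact assms(3))
  then show ?thesis using assms(1) by (simp add: card_PiE)
qed

lemma product_pigeonhole:
  assumes I: "finite I" and A: "\<And>i. i \<in> I \<Longrightarrow> finite (A i) \<and> A i \<noteq> {}"
    and T: "finite T" and P: "\<And>f. f \<in> PiE I A \<Longrightarrow> \<exists>t\<in>T. P t f"
    and V: "\<And>t. t \<in> T \<Longrightarrow> V t \<subseteq> I"
  shows "\<exists>t\<in>T. \<exists>g\<in>PiE (I - V t) A. (\<Prod>v\<in>V t. card (A v)) \<le>
    card T * (\<Prod>v\<in>V t. card (fibre_values {f \<in> PiE I A. P t f} (I - V t) g v))"
proof -
  have finite: "finite (PiE I A)" and "PiE I A \<noteq> {}"
    using I A by (auto intro: finite_PiE simp: PiE_eq_empty_iff)
  then have "T \<noteq> {}" using P by blast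
  then obtain t where t: "t \<in> T" "card (PiE I A) \<le> card T * card {f \<in> PiE I A. P t f}"
    using pigeonhole_cover[of T "PiE I A" P] T finite P by blast
  let ?F = "{f \<in> PiE I A. P t f}" and ?D = "I - V t"
  have finV: "finite (V t)" using V[OF t(1)] I finite_subset by blast
  obtain g where g: "g \<in> PiE ?D A"
    "card ?F \<le> (\<Prod>i\<in>?D. card (A i)) * card {f \<in> ?F. \<forall>i\<in>?D. f i = g i}"
    using ex_large_fibre[of ?D A ?F] I A finite by (auto simp: subset_iff)
  have D_pos: "(\<Prod>i\<in>?D. card (A i)) > 0" using A by (intro prod_pos) (auto simp: card_gt_0_iff)
  have "?F \<subseteq> extensional (?D \<union> V t)" using V[OF t(1)] by (auto simp: PiE_def Un_absorb2)
  then have fibre: "card {f \<in> ?F. \<forall>i\<in>?D. f i = g i} \<le> (\<Prod>v\<in>V t. card (fibre_values ?F ?D g v))"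
    by (rule card_fibre_le_prod_fibre_values[OF finV])
  have "(\<Prod>i\<in>?D. card (A i)) * (\<Prod>v\<in>V t. card (A v)) = card (PiE I A)"
    using prod.subset_diff[OF V[OF t(1)] I, of "\<lambda>i. card (A i)"] I by (simp add: card_PiE)
  also have "\<dots> \<le> card T * ((\<Prod>i\<in>?D. card (A i)) * card {f \<in> ?F. \<forall>i\<in>?D. f i = g i})"
    using t(2) g(2) by (meson le_trans mult_le_mono2)
  also have "\<dots> \<le> card T * ((\<Prod>i\<in>?D. card (A i)) * (\<Prod>v\<in>V t. card (fibre_values ?F ?D g v)))"
    using fibre by (intro mult_le_mono2)
  finally have "(\<Prod>v\<in>V t. card (A v)) \<le> card T * (\<Prod>v\<in>V t. card (fibre_values ?F ?D g v))"
    using D_pos by (simp add: mult.left_commute)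
  then show ?thesis using t(1) g(1) by blast
qed

lemma factor_le_of_prod_le:
  fixes a b :: "'i \<Rightarrow> nat"
  assumes "finite V" "v \<in> V" "\<And>w. w \<in> V \<Longrightarrow> b w \<le> a w" "\<And>w. w \<in> V \<Longrightarrow> 0 < a w"
    and "prod a V \<le> c * prod b V"
  shows "a v \<le> c * b v"
proof -
  have "prod a (V - {v}) * a v = prod a V" using assms(1,2) by (simp add: prod.remove)
  also have "\<dots> \<le> c * (b v * prod b (V - {v}))" using assms(1,2,5) by (simp add: prod.remove)
  also have "\<dots> \<le> c * (b v * prod a (V - {v}))"
    using assms(3) by (intro mult_le_mono2 prod_mono) auto
  finally have "prod a (V - {v}) * a v \<le> prod a (V - {v}) * (c * b v)" by (simp add: mult_ac)
  moreover have "0 < prod a (V - {v})" using assms(4) by (intro prod_pos) auto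
  ultimately show ?thesis by simp
qed

lemma coordinatewise_pigeonhole:
  assumes "finite I" "\<And>i. i \<in> I \<Longrightarrow> finite (A i) \<and> A i \<noteq> {}"
    and "finite T" "\<And>f. f \<in> PiE I A \<Longrightarrow> \<exists>t\<in>T. P t f" "\<And>t. t \<in> T \<Longrightarrow> V t \<subseteq> I"
  shows "\<exists>t\<in>T. \<exists>g\<in>PiE (I - V t) A. \<forall>v\<in>V t.
    card (A v) \<le> card T * card (fibre_values {f \<in> PiE I A. P t f} (I - V t) g v)"
proof -
  obtain t g where t: "t \<in> T" and g: "g \<in> PiE (I - V t) A" and prod: "(\<Prod>v\<in>V t. card (A v)) \<le>
      card T * (\<Prod>v\<in>V t. card (fibre_values {f \<in> PiE I A. P t f} (I - V t) g v))"
    using product_pigeonhole[of I A T P V] assms by blast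
  have "card (A v) \<le> card T * card (fibre_values {f \<in> PiE I A. P t f} (I - V t) g v)"
    if "v \<in> V t" for v
  proof (rule factor_le_of_prod_le[OF _ that _ _ prod])
    show "finite (V t)" using assms(1,5) t finite_subset by blast
    fix w assume "w \<in> V t"
    then have w: "w \<in> I" using assms(5)[OF t] by blast
    then show "card (fibre_values {f \<in> PiE I A. P t f} (I - V t) g w) \<le> card (A w)"
      using assms(2) by (intro card_mono fibre_values_subset[of _ I]) auto
    show "0 < card (A w)" using assms(2)[OF w] by (simp add: card_gt_0_iff)
  qed
  then show ?thesis using t g by blast
qed

lemma half_of_factors_large:
  fixes b :: "'i \<Rightarrow> nat"
  assumes "finite I" "\<And>i. i \<in> I \<Longrightarrow> b i \<le> s" "0 < s" "0 < q"
    and prod: "s ^ card I \<le> q ^ card I * prod b I"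
  shows "card I \<le> 2 * card {i \<in> I. s \<le> q\<^sup>2 * b i}"
proof (rule ccontr)
  define G where "G = {i \<in> I. s \<le> q\<^sup>2 * b i}"
  define N where "N = I - G"
  assume "\<not> ?thesis"
  then have few: "2 * card G < card I" by (simp add: G_def)
  have fin: "finite G" "finite N" and GI: "G \<subseteq> I" using assms(1) by (auto simp: G_def N_def)
  have card_N: "card N + card G = card I"
    using card_mono[OF assms(1) GI] fin GI by (simp add: N_def card_Diff_subset)
  then have "N \<noteq> {}" using few by auto
  then obtain i where i: "i \<in> N" by blast
  have small: "q\<^sup>2 * b i < s" if "i \<in> N" for i using that by (auto simp: N_def G_def)
  have "(\<Prod>i\<in>N. q\<^sup>2 * b i) < (\<Prod>i\<in>N. s)"
    by (rule prod_mono_strict[OF i _ fin(2)]) (use small i assms(3) in \<open>auto simp: less_imp_le\<close>)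
  then have N_small: "q ^ (2 * card N) * prod b N < s ^ card N"
    by (simp add: prod.distrib power_mult)
  have "prod b G \<le> (\<Prod>i\<in>G. s)" using GI assms(2) by (intro prod_mono) auto
  then have G_small: "prod b G \<le> s ^ card G" by simp
  have "q ^ card I * prod b I \<le> q ^ (2 * card N) * prod b I"
    using few card_N assms(4) by (intro mult_le_mono1 power_increasing) auto
  also have "\<dots> = q ^ (2 * card N) * prod b N * prod b G"
    using prod.subset_diff[OF GI assms(1), of b] by (simp add: N_def)
  also have "\<dots> \<le> q ^ (2 * card N) * prod b N * s ^ card G" using G_small by (rule mult_le_mono2)
  also have "\<dots> < s ^ card N * s ^ card G" using N_small assms(3) by simp
  also have "\<dots> = s ^ card I" by (simp add: card_N flip: power_add)
  finally show False using prod by simp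
qed

section \<open>Chains and monotone paths\<close>

lemma chain_or_antichain:
  assumes "finite Z" "transp_on Z P" "s * t \<le> card Z"
  shows "(\<exists>xs. length xs = s \<and> set xs \<subseteq> Z \<and> sorted_wrt P xs) \<or>
         (\<exists>C\<subseteq>Z. card C = t \<and> (\<forall>x\<in>C. \<forall>y\<in>C. \<not> P x y))"
  using assms
proof (induction s arbitrary: Z)
  case (Suc s)
  define A where "A = {z \<in> Z. \<forall>y\<in>Z. \<not> P y z}"
  have A: "A \<subseteq> Z" "finite A" using Suc.prems(1) by (auto simp: A_def)
  show ?case
  proof (cases "t \<le> card A")
    case True
    then obtain C where "C \<subseteq> A" "card C = t" by (meson obtain_subset_with_card_n)
    then show ?thesis by (intro disjI2 exI[of _ C]) (auto simp: A_def)
  next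
    case False
    have "s * t \<le> card (Z - A)" using Suc.prems(3) False A by (simp add: card_Diff_subset)
    then consider (chain) xs where "length xs = s" "set xs \<subseteq> Z - A" "sorted_wrt P xs"
      | (antichain) C where "C \<subseteq> Z - A" "card C = t" "\<forall>x\<in>C. \<forall>y\<in>C. \<not> P x y"
      using Suc.IH[of "Z - A"] Suc.prems(1,2) transp_on_subset[OF Suc.prems(2), of "Z - A"] by auto
    then show ?thesis
    proof cases
      case chain
      show ?thesis
      proof (cases xs)
        case Nil
        obtain z where "z \<in> Z" using False Suc.prems(3) by (cases "Z = {}") auto
        then show ?thesis using Nil chain(1) by (intro disjI1 exI[of _ "[z]"]) auto
      next
        case (Cons x ys)
        then obtain y where y: "y \<in> Z" "P y x" using chain(2) by (auto simp: A_def)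
        have "P y w" if "w \<in> set ys" for w
          using transp_onD[OF Suc.prems(2) y(1), of x w] y(2) that chain(2,3) Cons by auto
        then have "sorted_wrt P (y # xs)" using y(2) chain(3) Cons by auto
        then show ?thesis using y(1) chain by (intro disjI1 exI[of _ "y # xs"]) auto
      qed
    qed blast
  qed
qed auto

fun tight_path :: "('a \<Rightarrow> 'a \<Rightarrow> 'a \<Rightarrow> bool) \<Rightarrow> 'a list \<Rightarrow> bool" where
  "tight_path P (x # y # z # xs) \<longleftrightarrow> P x y z \<and> tight_path P (y # z # xs)"
| "tight_path P _ \<longleftrightarrow> True"

fun triplewise :: "('a \<Rightarrow> 'a \<Rightarrow> 'a \<Rightarrow> bool) \<Rightarrow> 'a list \<Rightarrow> bool" where
  "triplewise P [] \<longleftrightarrow> True"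
| "triplewise P (x # xs) \<longleftrightarrow> sorted_wrt (P x) xs \<and> triplewise P xs"

lemma triplewise_nth:
  "triplewise P xs \<Longrightarrow> i < j \<Longrightarrow> j < k \<Longrightarrow> k < length xs \<Longrightarrow> P (xs ! i) (xs ! j) (xs ! k)"
proof (induction xs arbitrary: i j k)
  case (Cons x xs)
  then obtain j' k' where "j = Suc j'" "k = Suc k'" by (metis less_imp_Suc_add add_Suc)
  then show ?case using Cons by (cases i) (auto simp: sorted_wrt_nth_less)
qed simp

lemma tight_path_ConsD: "tight_path P (x # xs) \<Longrightarrow> tight_path P xs"
  by (cases "(P, x # xs)" rule: tight_path.cases) auto

lemma tight_path_snoc:
  "tight_path P (xs @ [x, y, z]) \<longleftrightarrow> tight_path P (xs @ [x, y]) \<and> P x y z"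
  by (induction P xs rule: tight_path.induct) auto

definition transitive_triples :: "('a \<Rightarrow> 'a \<Rightarrow> bool) \<Rightarrow> 'a set \<Rightarrow> ('a \<Rightarrow> 'a \<Rightarrow> 'a \<Rightarrow> bool) \<Rightarrow> bool" where
  "transitive_triples lt S P \<longleftrightarrow> (\<forall>a\<in>S. \<forall>b\<in>S. \<forall>c\<in>S. \<forall>d\<in>S. lt a b \<longrightarrow> lt b c \<longrightarrow> lt c d \<longrightarrow>
     P a b c \<longrightarrow> P b c d \<longrightarrow> P a b d \<and> P a c d)"

lemma tight_path_imp_triplewise:
  assumes "tight_path P xs" "sorted_wrt lt xs" "set xs \<subseteq> S" "transitive_triples lt S P"
  shows "triplewise P xs"
  using assms(1-3)
proof (induction xs)
  case (Cons a xs)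
  have trans: "P a b d \<and> P a c d"
    if "b \<in> set xs" "c \<in> set xs" "d \<in> set xs" "lt b c" "lt c d" "P a b c" "P b c d" for b c d
    using assms(4) Cons.prems(2,3) that unfolding transitive_triples_def by fastforce
  have IH: "triplewise P xs"
    using Cons.prems tight_path_ConsD[OF Cons.prems(1)] by (intro Cons.IH) auto
  moreover have "sorted_wrt (P a) xs"
  proof (cases xs)
    case (Cons b ys)
    have b: "sorted_wrt (P b) ys" "sorted_wrt lt (b # ys)" using IH Cons.prems Cons by auto
    have ab: "P a b y" if "y \<in> set ys" for y
    proof (cases ys)
      case (Cons c zs)
      then show ?thesis using trans[of b c y] Cons.prems(1) \<open>xs = b # ys\<close> that b by auto
    qed (use that in simp)
    have "P a (ys ! i) (ys ! j)" if "i < j" "j < length ys" for i j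
      using trans[of b "ys ! i" "ys ! j"] ab that b Cons by (auto simp: sorted_wrt_nth_less)
    then have "sorted_wrt (P a) ys" by (simp add: sorted_wrt_iff_nth_less)
    then show ?thesis using ab Cons by simp
  qed simp
  ultimately show ?case by simp
qed simp

definition increasing_tight_path ::
    "('a \<Rightarrow> 'a \<Rightarrow> bool) \<Rightarrow> 'a set \<Rightarrow> ('a \<Rightarrow> 'a \<Rightarrow> 'a \<Rightarrow> bool) \<Rightarrow> 'a list \<Rightarrow> bool" where
  "increasing_tight_path lt S P xs \<longleftrightarrow> set xs \<subseteq> S \<and> sorted_wrt lt xs \<and> tight_path P xs"

lemma increasing_tight_path_mono:
  "increasing_tight_path lt A P xs \<Longrightarrow> A \<subseteq> B \<Longrightarrow> increasing_tight_path lt B P xs"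
  by (auto simp: increasing_tight_path_def)

lemma increasing_tight_path_Cons:
  assumes "increasing_tight_path lt S P (b # c # ys)" "transp_on S lt" "a \<in> S" "lt a b" "P a b c"
  shows "increasing_tight_path lt S P (a # b # c # ys)"
proof -
  have "lt a y" if "y \<in> set (c # ys)" for y
    using transp_onD[OF assms(2,3), of b y] assms(1,4) that
    by (auto simp: increasing_tight_path_def)
  then show ?thesis using assms by (simp add: increasing_tight_path_def)
qed

lemma increasing_tight_path_snoc:
  assumes "increasing_tight_path lt S P (xs @ [a, b])" "transp_on S lt" "c \<in> S" "lt b c" "P a b c"
  shows "increasing_tight_path lt S P (xs @ [a, b, c])"
proof -
  have "lt x c" if "x \<in> set (xs @ [a])" for x
    using transp_onD[OF assms(2), of x b c] assms(1,3,4) that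
    by (auto simp: increasing_tight_path_def sorted_wrt_append)
  then show ?thesis
    using assms by (auto simp: increasing_tight_path_def sorted_wrt_append tight_path_snoc)
qed

lemma ex_increasing_tight_path_2:
  assumes "totalp_on S lt" "2 \<le> card S"
  shows "\<exists>xs. length xs = 2 \<and> increasing_tight_path lt S P xs"
proof -
  have "finite S" using assms(2) card.infinite by fastforce
  then obtain x y where "x \<in> S" "y \<in> S" "x \<noteq> y"
    using card_le_Suc0_iff_eq[of S] assms(2) by auto
  then obtain x y where "x \<in> S" "y \<in> S" "lt x y" using assms(1) by (metis totalp_onD)
  then show ?thesis by (intro exI[of _ "[x, y]"]) (simp add: increasing_tight_path_def)
qed

definition path_ends :: "('a \<Rightarrow> 'a \<Rightarrow> bool) \<Rightarrow> 'a set \<Rightarrow> ('a \<Rightarrow> 'a \<Rightarrow> 'a \<Rightarrow> bool) \<Rightarrow> nat \<Rightarrow> 'a set" where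
  "path_ends lt S P n = {b \<in> S. \<exists>xs. length xs = n \<and> increasing_tight_path lt S P (xs @ [b])}"

lemma no_path_outside_path_ends:
  assumes "increasing_tight_path lt (S - path_ends lt S P n) P xs"
  shows "length xs \<noteq> Suc n"
proof
  assume "length xs = Suc n"
  then obtain ys b where ys: "xs = ys @ [b]" "length ys = n" by (cases xs rule: rev_cases) auto
  then have "increasing_tight_path lt S P (ys @ [b])"
    using increasing_tight_path_mono[OF assms] by blast
  then show False using assms ys by (auto simp: path_ends_def increasing_tight_path_def)
qed

lemma path_within_path_ends:
  assumes "transp_on S lt"
    and PQ: "\<forall>a\<in>S. \<forall>b\<in>S. \<forall>c\<in>S. lt a b \<longrightarrow> lt b c \<longrightarrow> P a b c \<or> Q a b c"
    and zs: "increasing_tight_path lt (path_ends lt S P (Suc k)) Q zs" "length zs = l + 2"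
  shows "(\<exists>xs. length xs = k + 3 \<and> increasing_tight_path lt S P xs) \<or>
         (\<exists>xs. length xs = l + 3 \<and> increasing_tight_path lt S Q xs)"
proof -
  obtain b c ys where bc: "zs = b # c # ys"
    using zs(2) by (auto simp: length_Suc_conv numeral_2_eq_2)
  then have "b \<in> path_ends lt S P (Suc k)" using zs(1) by (simp add: increasing_tight_path_def)
  then obtain ws where ws: "length ws = Suc k" "increasing_tight_path lt S P (ws @ [b])"
    by (auto simp: path_ends_def)
  then obtain xs a where xs: "ws = xs @ [a]" "length xs = k" by (cases ws rule: rev_cases) auto
  have P_path: "increasing_tight_path lt S P (xs @ [a, b])" using ws(2) xs(1) by simp
  have "path_ends lt S P (Suc k) \<subseteq> S" by (auto simp: path_ends_def)
  then have Q_path: "increasing_tight_path lt S Q (b # c # ys)"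
    using increasing_tight_path_mono[OF zs(1)] bc by blast
  have abc: "{a, b, c} \<subseteq> S" "lt a b" "lt b c"
    using P_path Q_path by (auto simp: increasing_tight_path_def sorted_wrt_append)
  consider (P) "P a b c" | (Q) "Q a b c" using PQ abc by auto
  then show ?thesis
  proof cases
    case P
    then have "increasing_tight_path lt S P (xs @ [a, b, c])"
      using increasing_tight_path_snoc[OF P_path assms(1)] abc by blast
    then show ?thesis using xs(2) by (intro disjI1 exI[of _ "xs @ [a, b, c]"]) simp
  next
    case Q
    then have "increasing_tight_path lt S Q (a # zs)"
      using increasing_tight_path_Cons[OF Q_path assms(1)] abc bc by blast
    then show ?thesis using zs(2) by (intro disjI2 exI[of _ "a # zs"]) simp
  qed
qed

lemma ex_increasing_tight_path:
  assumes "finite S" "transp_on S lt" "totalp_on S lt"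
    and "\<forall>a\<in>S. \<forall>b\<in>S. \<forall>c\<in>S. lt a b \<longrightarrow> lt b c \<longrightarrow> P a b c \<or> Q a b c"
    and "(k + l) choose k < card S"
  shows "(\<exists>xs. length xs = k + 2 \<and> increasing_tight_path lt S P xs) \<or>
         (\<exists>xs. length xs = l + 2 \<and> increasing_tight_path lt S Q xs)"
  using assms
proof (induction "k + l" arbitrary: k l S rule: less_induct)
  case less
  show ?case
  proof (cases "k = 0 \<or> l = 0")
    case True
    then have "2 \<le> card S" using less.prems(5) by auto
    then show ?thesis using ex_increasing_tight_path_2[OF less.prems(3)] True by (metis add_0)
  next
    case False
    then obtain k' l' where kl: "k = Suc k'" "l = Suc l'" by (meson not0_implies_Suc)
    let ?A = "path_ends lt S P k"
    have A: "?A \<subseteq> S" by (auto simp: path_ends_def)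
    have IH: "(\<exists>xs. length xs = i + 2 \<and> increasing_tight_path lt B P xs) \<or>
         (\<exists>xs. length xs = j + 2 \<and> increasing_tight_path lt B Q xs)"
      if "i + j < k + l" "B \<subseteq> S" "(i + j) choose i < card B" for i j B
      using less.prems(1-4) that
      by (intro less.hyps) (auto intro: finite_subset transp_on_subset totalp_on_subset)
    have "card S = card (S - ?A) + card ?A"
      using A less.prems(1) by (metis card_Diff_subset card_mono finite_subset le_add_diff_inverse2)
    moreover have "(k + l) choose k = (k' + l choose k') + (k + l' choose k)" using kl by simp
    ultimately consider (few) "(k' + l) choose k' < card (S - ?A)"
      | (many) "(k + l') choose k < card ?A"
      using less.prems(5) by linarith
    then show ?thesis
    proof cases
      case few
      then show ?thesis
        using IH[of k' l "S - ?A"] no_path_outside_path_ends[of lt S P k] kl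
          increasing_tight_path_mono[of lt "S - ?A" Q _ S] by auto
    next
      case many
      then consider (P) xs where "length xs = k + 2" "increasing_tight_path lt ?A P xs"
        | (Q) ys where "length ys = l' + 2" "increasing_tight_path lt ?A Q ys"
        using IH[of k l' ?A] kl A by auto
      then show ?thesis
        using increasing_tight_path_mono[OF _ A] path_within_path_ends[OF less.prems(2), of P Q k']
          less.prems(4) kl
        by cases (auto simp: numeral_eq_Suc)
    qed
  qed
qed

theorem cups_caps:
  assumes "finite S" "transp_on S lt" "totalp_on S lt"
    and "\<forall>a\<in>S. \<forall>b\<in>S. \<forall>c\<in>S. lt a b \<longrightarrow> lt b c \<longrightarrow> P a b c \<or> Q a b c"
    and "transitive_triples lt S P" "transitive_triples lt S Q"
    and "(k + l) choose k < card S"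
  shows "(\<exists>xs. length xs = k + 2 \<and> set xs \<subseteq> S \<and> sorted_wrt lt xs \<and> triplewise P xs) \<or>
         (\<exists>xs. length xs = l + 2 \<and> set xs \<subseteq> S \<and> sorted_wrt lt xs \<and> triplewise Q xs)"
proof -
  have "triplewise R xs"
    if "increasing_tight_path lt S R xs" "transitive_triples lt S R" for R xs
    using that tight_path_imp_triplewise unfolding increasing_tight_path_def by blast
  then show ?thesis
    using ex_increasing_tight_path[OF assms(1-4,7)] assms(5,6)
    unfolding increasing_tight_path_def by blast
qed

section \<open>Orientations of quadruples\<close>

lemma sgn_weighted_sum:
  fixes u v w x y z :: real
  assumes "w * z = u * x + v * y" "w \<noteq> 0" "sgn u = sgn w" "sgn v = sgn w" "sgn x = sgn y"
  shows "sgn z = sgn x"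
proof -
  have weights: "u / w > 0" "v / w > 0"
    using assms(2-4) by (auto simp: sgn_if zero_less_divide_iff split: if_splits)
  have z: "z = (u / w) * x + (v / w) * y" using assms(1,2) by (simp add: field_simps)
  consider (pos) "x > 0" "y > 0" | (neg) "x < 0" "y < 0" | (zero) "x = 0" "y = 0"
    using assms(5) by (auto simp: sgn_if split: if_splits)
  then show ?thesis
  proof cases
    case pos
    then have "z > 0" unfolding z using weights by (intro add_pos_pos mult_pos_pos)
    then show ?thesis using pos by simp
  next
    case neg
    then have "z < 0" unfolding z using weights by (intro add_neg_neg mult_pos_neg)
    then show ?thesis using neg by simp
  qed (simp add: z)
qed

text \<open>The sign of \<open>ori a b c d\<close> tells on which side of the plane through \<open>a\<close>, \<open>b\<close>, \<open>c\<close> the point \<open>d\<close>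
  lies.\<close>
locale chirotope =
  fixes ori :: "'p \<Rightarrow> 'p \<Rightarrow> 'p \<Rightarrow> 'p \<Rightarrow> real"
  assumes swap12: "ori b a c d = - ori a b c d"
    and swap23: "ori a c b d = - ori a b c d"
    and swap34: "ori a b d c = - ori a b c d"
    and grassmann_pluecker:
      "ori a b c d * ori a b e f - ori a b c e * ori a b d f + ori a b c f * ori a b d e = 0"
begin

definition orientations :: "('p \<Rightarrow> 'p \<Rightarrow> 'p \<Rightarrow> 'p \<Rightarrow> real) set" where
  "orientations = {ori, \<lambda>a b c d. - ori a b c d}"

lemma chirotope_orientations:
  assumes "ori' \<in> orientations"
  shows "chirotope ori'"
proof -
  have "chirotope (\<lambda>a b c d. - ori a b c d)"
  proof
    show "- ori b a c d = - (- ori a b c d)" for a b c d using swap12[of b a c d] by simp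
    show "- ori a c b d = - (- ori a b c d)" for a b c d using swap23[of a c b d] by simp
    show "- ori a b d c = - (- ori a b c d)" for a b c d using swap34[of a b d c] by simp
    show "- ori a b c d * - ori a b e f - - ori a b c e * - ori a b d f +
        - ori a b c f * - ori a b d e = 0" for a b c d e f
      using grassmann_pluecker[of a b c d e f] by simp
  qed
  then show ?thesis using assms chirotope_axioms by (auto simp: orientations_def)
qed

lemma ori_rotate: "ori a b c d = ori a d b c"
  using swap34[of a b c d] swap23[of a b d c] by simp

lemma ori_repeat [simp]: "ori a b c a = 0" "ori a b c b = 0" "ori a b c c = 0"
proof -
  show self34: "ori a b c c = 0" for a b c using swap34[of a b c c] by simp
  show self24: "ori a b c b = 0" for a b c using swap23[of a c b b] self34[of a c b] by simp
  show "ori a b c a = 0" using swap12[of b a c a] self24[of b a c] by simp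
qed

definition nondegenerate :: "'p set \<Rightarrow> bool" where
  "nondegenerate X \<longleftrightarrow> (\<forall>a b c d. {a, b, c, d} \<subseteq> X \<longrightarrow> distinct [a, b, c, d] \<longrightarrow> ori a b c d \<noteq> 0)"

lemma nondegenerate_subset: "nondegenerate X \<Longrightarrow> Y \<subseteq> X \<Longrightarrow> nondegenerate Y"
  unfolding nondegenerate_def by (meson subset_trans)

lemma nondegenerate_orientations:
  assumes "ori' \<in> orientations" "nondegenerate X"
  shows "chirotope.nondegenerate ori' X"
  using assms chirotope.nondegenerate_def[OF chirotope_orientations[OF assms(1)]]
  by (auto simp: orientations_def nondegenerate_def)

text \<open>Seen along the line \<open>a b\<close>, the hypotheses put \<open>x\<close> into the cone spanned by \<open>l\<close> and \<open>r\<close>.\<close>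
lemma sgn_ori_interpolate:
  assumes "ori a b l r \<noteq> 0"
    and "sgn (ori a b l x) = sgn (ori a b l r)" "sgn (ori a b x r) = sgn (ori a b l r)"
    and "sgn (ori a b l y) = sgn (ori a b r y)"
  shows "sgn (ori a b x y) = sgn (ori a b l y)"
proof -
  have "ori a b l r * ori a b x y = ori a b l x * ori a b r y + ori a b x r * ori a b l y"
    using grassmann_pluecker[of a b l r x y] swap34[of a b r x] by (simp add: mult.commute)
  from sgn_weighted_sum[OF this] show ?thesis using assms by simp
qed

definition axis_less :: "'p \<Rightarrow> 'p \<Rightarrow> 'p \<Rightarrow> 'p \<Rightarrow> bool" where
  "axis_less a b y z \<longleftrightarrow> 0 < ori a b y z"

definition strict_axis_order :: "'p \<Rightarrow> 'p \<Rightarrow> 'p set \<Rightarrow> bool" where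
  "strict_axis_order a b Z \<longleftrightarrow> transp_on Z (axis_less a b) \<and> totalp_on Z (axis_less a b)"

lemma strict_axis_order_subset:
  "strict_axis_order a b Z \<Longrightarrow> Z' \<subseteq> Z \<Longrightarrow> strict_axis_order a b Z'"
  unfolding strict_axis_order_def using transp_on_subset totalp_on_subset by blast

lemma axis_less_imp_neq: "axis_less a b y z \<Longrightarrow> y \<noteq> z"
  by (auto simp: axis_less_def)

text \<open>The half-planes bounded by the line \<open>a b\<close> through the points of \<open>Z\<close> all lie on the same side of
  \<open>r\<close>, so that rotating around the line orders them.\<close>
lemma strict_axis_orderI:
  assumes same_side: "\<And>y z. y \<in> Z \<Longrightarrow> z \<in> Z \<Longrightarrow> sgn (ori a b r y) = sgn (ori a b r z)"
    and "\<And>z. z \<in> Z \<Longrightarrow> ori a b r z \<noteq> 0"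
    and "\<And>y z. y \<in> Z \<Longrightarrow> z \<in> Z \<Longrightarrow> y \<noteq> z \<Longrightarrow> ori a b y z \<noteq> 0"
  shows "strict_axis_order a b Z"
  unfolding strict_axis_order_def
proof
  show "transp_on Z (axis_less a b)"
  proof (rule transp_onI)
    fix x y z assume xyz: "x \<in> Z" "y \<in> Z" "z \<in> Z" and less: "axis_less a b x y" "axis_less a b y z"
    have "ori a b r y * ori a b x z = ori a b r z * ori a b x y + ori a b r x * ori a b y z"
      using grassmann_pluecker[of a b r x y z] by simp
    from sgn_weighted_sum[OF this assms(2) same_side same_side]
    have "sgn (ori a b x z) = sgn (ori a b x y)"
      using less xyz by (simp add: axis_less_def)
    then show "axis_less a b x z" using less(1) by (simp add: axis_less_def sgn_if split: if_splits)
  qed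
  show "totalp_on Z (axis_less a b)"
  proof (rule totalp_onI)
    fix y z assume "y \<in> Z" "z \<in> Z" "y \<noteq> z"
    then show "axis_less a b y z \<or> axis_less a b z y"
      using assms(3)[of y z] swap34[of a b z y] by (auto simp: axis_less_def)
  qed
qed

definition axes_agree :: "'p \<Rightarrow> 'p \<Rightarrow> 'p \<Rightarrow> 'p \<Rightarrow> 'p set \<Rightarrow> bool" where
  "axes_agree a b c d Z \<longleftrightarrow> (\<forall>y\<in>Z. \<forall>z\<in>Z. y \<noteq> z \<longrightarrow> 0 < ori a b y z * ori c d y z)"

lemma axes_agree_sgn:
  "axes_agree a b c d Z \<Longrightarrow> y \<in> Z \<Longrightarrow> z \<in> Z \<Longrightarrow> sgn (ori a b y z) = sgn (ori c d y z)"
  unfolding axes_agree_def by (metis ori_repeat(3) sgn_neg sgn_pos zero_less_mult_iff)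

lemma axes_agree_subset: "axes_agree a b c d Z \<Longrightarrow> Z' \<subseteq> Z \<Longrightarrow> axes_agree a b c d Z'"
  by (auto simp: axes_agree_def)

lemma axes_agree_sym: "axes_agree a b c d Z \<Longrightarrow> axes_agree c d a b Z"
  by (simp add: axes_agree_def mult.commute)

lemma axes_agree_trans: "axes_agree a b c d Z \<Longrightarrow> axes_agree c d e f Z \<Longrightarrow> axes_agree a b e f Z"
  unfolding axes_agree_def by (metis zero_less_mult_iff order_less_asym)

lemma axis_orders_split:
  assumes "finite Z" "s * t \<le> card Z" "strict_axis_order a b Z" "strict_axis_order c d Z"
  shows "(\<exists>Z'\<subseteq>Z. card Z' = s \<and> axes_agree a b c d Z') \<or> (\<exists>Z'\<subseteq>Z. card Z' = t \<and> axes_agree b a c d Z')"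
proof -
  let ?P = "\<lambda>y z. axis_less a b y z \<and> axis_less c d y z"
  have "transp_on Z ?P"
    using assms(3,4) unfolding strict_axis_order_def transp_on_def by blast
  with assms(1) consider (chain) xs where "length xs = s" "set xs \<subseteq> Z" "sorted_wrt ?P xs"
    | (antichain) C where "C \<subseteq> Z" "card C = t" "\<And>y z. y \<in> C \<Longrightarrow> z \<in> C \<Longrightarrow> \<not> ?P y z"
    using chain_or_antichain[OF _ _ assms(2), of ?P] by blast
  then show ?thesis
  proof cases
    case chain
    then have P: "?P (xs ! i) (xs ! j)" if "i < j" "j < length xs" for i j
      using that by (simp add: sorted_wrt_iff_nth_less)
    have "distinct xs"
      unfolding distinct_conv_nth using P axis_less_imp_neq by (metis linorder_neqE_nat)
    moreover have "axes_agree a b c d (set xs)"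
      unfolding axes_agree_def
    proof (intro ballI impI)
      fix y z assume "y \<in> set xs" "z \<in> set xs" "y \<noteq> z"
      then have "?P y z \<or> ?P z y" using P by (metis in_set_conv_nth linorder_neqE_nat)
      then show "0 < ori a b y z * ori c d y z"
        using swap34[of a b y z] swap34[of c d y z] by (auto simp: axis_less_def zero_less_mult_iff)
    qed
    ultimately show ?thesis using chain(1,2) distinct_card by blast
  next
    case antichain
    have "axes_agree b a c d C"
      unfolding axes_agree_def
    proof (intro ballI impI)
      fix y z assume yz: "y \<in> C" "z \<in> C" "y \<noteq> z"
      then have "axis_less a b y z \<or> axis_less a b z y" "axis_less c d y z \<or> axis_less c d z y"
        using assms(3,4) antichain(1) unfolding strict_axis_order_def totalp_on_def by blast+
      then show "0 < ori b a y z * ori c d y z"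
        using antichain(3)[OF yz(1,2)] antichain(3)[OF yz(2,1)]
          swap34[of a b y z] swap34[of c d y z] swap12[of b a y z]
        by (auto simp: axis_less_def mult_less_0_iff)
    qed
    then show ?thesis using antichain(1,2) by blast
  qed
qed

section \<open>Bulges\<close>

text \<open>In the projection from \<open>q\<close>, the points of the list form a convex chain bulging away from \<open>r\<close> if
  \<open>s = 1\<close>, and towards \<open>r\<close> if \<open>s = -1\<close>.\<close>
definition bulge :: "real \<Rightarrow> 'p \<Rightarrow> 'p \<Rightarrow> 'p list \<Rightarrow> bool" where
  "bulge s q r ys \<longleftrightarrow> sorted_wrt (axis_less q r) ys \<and> triplewise (\<lambda>x y z. 0 < s * ori q x y z) ys"

lemma transitive_triples_ori:
  assumes "transp_on Z (axis_less q r)"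
  shows "transitive_triples (axis_less q r) Z (\<lambda>x y z. 0 < s * ori q x y z)"
  unfolding transitive_triples_def
proof (intro ballI impI)
  fix a b c d assume Z: "a \<in> Z" "b \<in> Z" "c \<in> Z" "d \<in> Z"
    and less: "axis_less q r a b" "axis_less q r b c" "axis_less q r c d"
    and pos: "0 < s * ori q a b c" "0 < s * ori q b c d"
  have "axis_less q r a c" "axis_less q r b d" using less Z transp_onD[OF assms] by blast+
  note less = less this[unfolded axis_less_def] less[unfolded axis_less_def]
  have "ori q r b c * ori q a b d = ori q r a b * ori q b c d + ori q r b d * ori q a b c"
    using grassmann_pluecker[of q b r a c d] swap23[of q b r c] swap23[of q b r d] swap23[of q b a c]
      swap23[of q b a d] ori_rotate[of q r a b] by simp
  then have "ori q r b c * (s * ori q a b d) =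
      ori q r a b * (s * ori q b c d) + ori q r b d * (s * ori q a b c)"
    by (simp add: algebra_simps)
  from sgn_weighted_sum[OF this] have abd: "sgn (s * ori q a b d) = 1" using less pos by simp
  have "ori q r b c * ori q a c d = ori q r a c * ori q b c d + ori q r c d * ori q a b c"
    using grassmann_pluecker[of q c r a b d] swap23[of q c r d] swap23[of q c b d] swap23[of q c a d]
      ori_rotate[of q r a c] ori_rotate[of q r b c] ori_rotate[of q a b c] by simp
  then have "ori q r b c * (s * ori q a c d) =
      ori q r a c * (s * ori q b c d) + ori q r c d * (s * ori q a b c)"
    by (simp add: algebra_simps)
  from sgn_weighted_sum[OF this] have "sgn (s * ori q a c d) = 1" using less pos by simp
  with abd show "0 < s * ori q a b d \<and> 0 < s * ori q a c d"
    by (simp add: sgn_1_pos)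
qed

lemma ex_bulge:
  assumes "finite Z" "nondegenerate X" "Z \<subseteq> X" "q \<in> X - Z" and order: "strict_axis_order q r Z"
    and "(k + l) choose k < card Z"
  shows "(\<exists>ys. length ys = k + 2 \<and> set ys \<subseteq> Z \<and> bulge (- 1) q r ys) \<or>
         (\<exists>ys. length ys = l + 2 \<and> set ys \<subseteq> Z \<and> bulge 1 q r ys)"
  unfolding bulge_def
proof (rule cups_caps[OF assms(1)])
  show trans: "transp_on Z (axis_less q r)" and "totalp_on Z (axis_less q r)"
    using order by (simp_all add: strict_axis_order_def)
  show "transitive_triples (axis_less q r) Z (\<lambda>x y z. 0 < - 1 * ori q x y z)"
    "transitive_triples (axis_less q r) Z (\<lambda>x y z. 0 < 1 * ori q x y z)"
    by (rule transitive_triples_ori[OF trans])+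
  show "\<forall>a\<in>Z. \<forall>b\<in>Z. \<forall>c\<in>Z. axis_less q r a b \<longrightarrow> axis_less q r b c \<longrightarrow>
    0 < - 1 * ori q a b c \<or> 0 < 1 * ori q a b c"
  proof (intro ballI impI)
    fix a b c assume abc: "a \<in> Z" "b \<in> Z" "c \<in> Z" and less: "axis_less q r a b" "axis_less q r b c"
    then have "axis_less q r a c" using transp_onD[OF trans, of a b c] by simp
    with less have "distinct [q, a, b, c]" using abc assms(4) by (auto dest: axis_less_imp_neq)
    moreover have "{q, a, b, c} \<subseteq> X" using assms(3,4) abc by auto
    ultimately have "ori q a b c \<noteq> 0" using assms(2) unfolding nondegenerate_def by blast
    then show "0 < - 1 * ori q a b c \<or> 0 < 1 * ori q a b c" by auto
  qed
qed (fact assms(6))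

lemma bulge_cuts:
  assumes "bulge s q r ys" "2 * i + 2 < length ys"
  shows bulge_cuts_own: "0 < s * ori q (ys ! (2 * i + 2)) (ys ! (2 * i)) (ys ! (2 * i + 1))"
    and bulge_cuts_other: "2 * j + 2 < length ys \<Longrightarrow> j \<noteq> i \<Longrightarrow>
      s * ori q (ys ! (2 * i + 2)) (ys ! (2 * i)) (ys ! (2 * j + 1)) < 0"
proof -
  have pos: "0 < s * ori q (ys ! i) (ys ! j) (ys ! k)" if "i < j" "j < k" "k < length ys" for i j k
    using triplewise_nth[of "\<lambda>x y z. 0 < s * ori q x y z", OF _ that] assms(1)
    by (simp add: bulge_def)
  let ?y = "\<lambda>i. ys ! i"
  show "0 < s * ori q (?y (2 * i + 2)) (?y (2 * i)) (?y (2 * i + 1))"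
    using pos[of "2 * i" "2 * i + 1" "2 * i + 2"] assms(2)
      ori_rotate[of q "?y (2 * i)" "?y (2 * i + 1)" "?y (2 * i + 2)"] by simp
  assume j: "2 * j + 2 < length ys" "j \<noteq> i"
  show "s * ori q (?y (2 * i + 2)) (?y (2 * i)) (?y (2 * j + 1)) < 0"
  proof (cases "j < i")
    case True
    then show ?thesis
      using pos[of "2 * j + 1" "2 * i" "2 * i + 2"] assms(2)
        ori_rotate[of q "?y (2 * j + 1)" "?y (2 * i)" "?y (2 * i + 2)"]
        swap34[of q "?y (2 * i + 2)" "?y (2 * j + 1)" "?y (2 * i)"] by simp
  next
    case False
    then show ?thesis
      using pos[of "2 * i" "2 * i + 2" "2 * j + 1"] j
        swap23[of q "?y (2 * i + 2)" "?y (2 * i)" "?y (2 * j + 1)"] by simp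
  qed
qed

section \<open>Points cut off by planes\<close>

definition separating_planes ::
    "'i set \<Rightarrow> ('i \<Rightarrow> 'p) \<Rightarrow> ('i \<Rightarrow> 'p) \<Rightarrow> ('i \<Rightarrow> 'p) \<Rightarrow> ('i \<Rightarrow> 'p set) \<Rightarrow> bool" where
  "separating_planes I a b c B \<longleftrightarrow> (\<forall>i\<in>I. (\<forall>x\<in>B i. 0 < ori (a i) (b i) (c i) x) \<and>
     (\<forall>j\<in>I - {i}. \<forall>x\<in>B j. ori (a i) (b i) (c i) x < 0))"

lemma separating_planes_reindex:
  assumes "separating_planes I a b c B" "inj_on h J" "h ` J \<subseteq> I"
  shows "separating_planes J (a \<circ> h) (b \<circ> h) (c \<circ> h) (B \<circ> h)"
proof -
  have "h i \<in> I" if "i \<in> J" for i using assms(3) that by blast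
  moreover have "h j \<in> I - {h i}" if "i \<in> J" "j \<in> J - {i}" for i j
    using assms(2,3) that by (auto dest: inj_onD)
  ultimately show ?thesis using assms(1) unfolding separating_planes_def comp_def by meson
qed

definition cut_off_points :: "'p set \<Rightarrow> nat \<Rightarrow> bool" where
  "cut_off_points X n \<longleftrightarrow>
     (\<exists>v a b c. {v, a, b, c} \<subseteq> {..<n} \<rightarrow> X \<and> separating_planes {..<n} a b c (\<lambda>i. {v i}))"

lemma cut_off_pointsI:
  assumes "finite I" "n \<le> card I" "{v, a, b, c} \<subseteq> I \<rightarrow> X" "separating_planes I a b c (\<lambda>i. {v i})"
  shows "cut_off_points X n"
proof -
  obtain h where h: "bij_betw h {..<card I} I"
    using ex_bij_betw_nat_finite[OF assms(1)] by (auto simp: atLeast0LessThan)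
  have inj: "inj_on h {..<n}" and sub: "h ` {..<n} \<subseteq> I"
    using h assms(2) by (auto simp: bij_betw_def intro: inj_on_subset)
  have "separating_planes {..<n} (a \<circ> h) (b \<circ> h) (c \<circ> h) (\<lambda>i. {(v \<circ> h) i})"
    using separating_planes_reindex[OF assms(4) inj sub] by (simp add: comp_def)
  moreover have "{v \<circ> h, a \<circ> h, b \<circ> h, c \<circ> h} \<subseteq> {..<n} \<rightarrow> X"
    using assms(3) sub by (auto simp: Pi_iff)
  ultimately show ?thesis unfolding cut_off_points_def by blast
qed

lemma cut_off_points_orientations:
  assumes "ori' \<in> orientations" "chirotope.cut_off_points ori' X n"
  shows "cut_off_points X n"
proof -
  interpret oriented: chirotope ori' using assms(1) by (rule chirotope_orientations)
  obtain v a b c where vabc: "{v, a, b, c} \<subseteq> {..<n} \<rightarrow> X"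
      "oriented.separating_planes {..<n} a b c (\<lambda>i. {v i})"
    using assms(2) unfolding oriented.cut_off_points_def by blast
  consider (same) "ori' = ori" | (reversed) "ori' = (\<lambda>a b c d. - ori a b c d)"
    using assms(1) by (auto simp: orientations_def)
  then show ?thesis
  proof cases
    case same
    then show ?thesis using assms(2) by simp
  next
    case reversed
    have "separating_planes {..<n} b a c (\<lambda>i. {v i})"
      using vabc(2) unfolding oriented.separating_planes_def separating_planes_def
      by (simp add: reversed swap12[of "b _" "a _"])
    moreover have "{v, b, a, c} \<subseteq> {..<n} \<rightarrow> X" using vabc(1) by auto
    ultimately show ?thesis unfolding cut_off_points_def by blast
  qed
qed

lemma inward_bulge_cut_off_points:
  assumes bulge: "bulge (- 1) q r ys" and "2 * n < length ys" "insert q (set ys) \<subseteq> X"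
  shows "cut_off_points X n"
proof (rule cut_off_pointsI[where I = "{..<n}"])
  show "{\<lambda>i. ys ! (2 * i + 1), \<lambda>_. q, \<lambda>i. ys ! (2 * i), \<lambda>i. ys ! (2 * i + 2)} \<subseteq> {..<n} \<rightarrow> X"
    using assms(2,3) by (auto simp: subset_iff)
  show "separating_planes {..<n} (\<lambda>_. q) (\<lambda>i. ys ! (2 * i)) (\<lambda>i. ys ! (2 * i + 2))
      (\<lambda>i. {ys ! (2 * i + 1)})"
    unfolding separating_planes_def swap23[of q _ "ys ! (2 * _ + 2)"]
    using bulge_cuts_own[OF bulge] bulge_cuts_other[OF bulge] assms(2) by auto
qed auto

text \<open>Seen from \<open>q\<close>, every line through two points of \<open>Z\<close> leaves \<open>r\<close> and all of \<open>U\<close> on the same side.\<close>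
definition sees_one_sided :: "'p \<Rightarrow> 'p \<Rightarrow> 'p set \<Rightarrow> 'p set \<Rightarrow> bool" where
  "sees_one_sided q r Z U \<longleftrightarrow> strict_axis_order q r Z \<and>
     (\<forall>y\<in>Z. \<forall>z\<in>Z. axis_less q r y z \<longrightarrow> (\<forall>x\<in>U. 0 < ori q x y z))"

lemma sees_one_sidedD:
  "sees_one_sided q r Z U \<Longrightarrow> y \<in> Z \<Longrightarrow> z \<in> Z \<Longrightarrow> axis_less q r y z \<Longrightarrow> x \<in> U \<Longrightarrow> 0 < ori q x y z"
  by (simp add: sees_one_sided_def)

lemma sees_one_sided_mono:
  "sees_one_sided q r Z U \<Longrightarrow> Z' \<subseteq> Z \<Longrightarrow> U' \<subseteq> U \<Longrightarrow> sees_one_sided q r Z' U'"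
  unfolding sees_one_sided_def using strict_axis_order_subset by blast

lemma outward_bulges_cut_off_points:
  assumes "finite F" "n \<le> card F * l"
    and bulge: "\<And>j. j \<in> F \<Longrightarrow> bulge 1 (q j) (r j) (ys j)"
    and ys: "\<And>j. j \<in> F \<Longrightarrow> 2 * l < length (ys j) \<and> insert (q j) (set (ys j)) \<subseteq> X"
    and one_sided: "\<And>j. j \<in> F \<Longrightarrow> sees_one_sided (q j) (r j) (set (ys j)) (\<Union>i\<in>F - {j}. set (ys i))"
  shows "cut_off_points X n"
proof (rule cut_off_pointsI[where I = "F \<times> {..<l}"])
  let ?v = "\<lambda>(j, i). ys j ! (2 * i + 1)" and ?q = "\<lambda>(j, i). q j"
    and ?next = "\<lambda>(j, i). ys j ! (2 * i + 2)" and ?prev = "\<lambda>(j, i). ys j ! (2 * i)"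
  show "{?v, ?q, ?next, ?prev} \<subseteq> F \<times> {..<l} \<rightarrow> X" using ys by (force simp: subset_iff)
  have other: "ori (q j) (ys j ! (2 * i + 2)) (ys j ! (2 * i)) (ys j' ! (2 * i' + 1)) < 0"
    if "j \<in> F" "i < l" "j' \<in> F" "i' < l" "j' \<noteq> j \<or> i' \<noteq> i" for j i j' i'
  proof (cases "j' = j")
    case True
    then show ?thesis
      using bulge_cuts_other[OF bulge[OF that(1)], of i i'] ys[OF that(1)] that by simp
  next
    case False
    have "axis_less (q j) (r j) (ys j ! (2 * i)) (ys j ! (2 * i + 2))"
      using bulge[OF that(1)] ys[OF that(1)] that(2) by (simp add: bulge_def sorted_wrt_nth_less)
    moreover have "ys j' ! (2 * i' + 1) \<in> (\<Union>i\<in>F - {j}. set (ys i))"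
      using ys[OF that(3)] that False by (intro UN_I[of j']) auto
    ultimately have "0 < ori (q j) (ys j' ! (2 * i' + 1)) (ys j ! (2 * i)) (ys j ! (2 * i + 2))"
      using ys[OF that(1)] that(2) by (intro sees_one_sidedD[OF one_sided[OF that(1)]]) auto
    then show ?thesis
      using ori_rotate[of "q j" "ys j' ! (2 * i' + 1)"]
        swap34[of "q j" "ys j ! (2 * i + 2)" "ys j' ! (2 * i' + 1)"] by simp
  qed
  have own: "0 < ori (q j) (ys j ! (2 * i + 2)) (ys j ! (2 * i)) (ys j ! (2 * i + 1))"
    if "j \<in> F" "i < l" for j i
    using bulge_cuts_own[OF bulge[OF that(1)], of i] ys[OF that(1)] that by simp
  show "separating_planes (F \<times> {..<l}) ?q ?next ?prev (\<lambda>p. {?v p})"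
    unfolding separating_planes_def
  proof (intro ballI conjI)
    fix p x assume "p \<in> F \<times> {..<l}" "x \<in> {?v p}"
    then show "0 < ori (?q p) (?next p) (?prev p) x" using own by auto
  next
    fix p p' x assume "p \<in> F \<times> {..<l}" "p' \<in> F \<times> {..<l} - {p}" "x \<in> {?v p'}"
    then show "ori (?q p) (?next p) (?prev p) x < 0"
      using other[of "fst p" "snd p" "fst p'" "snd p'"] by (auto simp: prod_eq_iff case_prod_beta)
  qed
qed (use assms(1,2) in auto)

lemma one_sided_clusters_cut_off_points:
  assumes "finite X" "nondegenerate X" "finite F" "n \<le> card F * l"
    and Z: "\<And>j. j \<in> F \<Longrightarrow> Z j \<subseteq> X \<and> (2 * n + 2 * l choose (2 * l)) < card (Z j)"
    and one_sided: "\<And>j. j \<in> F \<Longrightarrow> \<exists>q r. q \<in> X - Z j \<and> sees_one_sided q r (Z j) (\<Union>i\<in>F - {j}. Z i)"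
  shows "cut_off_points X n"
proof (cases "\<exists>j\<in>F. \<exists>q r ys. q \<in> X \<and> length ys = 2 * n + 2 \<and> set ys \<subseteq> Z j \<and> bulge (- 1) q r ys")
  case True
  then obtain j q r ys where "j \<in> F" "q \<in> X" "length ys = 2 * n + 2" "set ys \<subseteq> Z j"
      "bulge (- 1) q r ys"
    by blast
  then show ?thesis using Z by (intro inward_bulge_cut_off_points[of q r ys]) auto
next
  case False
  have "\<exists>q r ys. q \<in> X \<and> sees_one_sided q r (Z j) (\<Union>i\<in>F - {j}. Z i) \<and> length ys = 2 * l + 2 \<and>
      set ys \<subseteq> Z j \<and> bulge 1 q r ys" if j: "j \<in> F" for j
  proof -
    obtain q r where qr: "q \<in> X - Z j" "sees_one_sided q r (Z j) (\<Union>i\<in>F - {j}. Z i)"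
      using one_sided[OF j] by blast
    have "(2 * n + 2 * l choose (2 * n)) < card (Z j)"
      using Z[OF j] binomial_symmetric[of "2 * n" "2 * n + 2 * l"] by simp
    then have "(\<exists>ys. length ys = 2 * n + 2 \<and> set ys \<subseteq> Z j \<and> bulge (- 1) q r ys) \<or>
        (\<exists>ys. length ys = 2 * l + 2 \<and> set ys \<subseteq> Z j \<and> bulge 1 q r ys)"
      using Z[OF j] assms(1,2) qr finite_subset by (intro ex_bulge) (auto simp: sees_one_sided_def)
    then show ?thesis using False j qr by blast
  qed
  then obtain q r ys where qry: "\<And>j. j \<in> F \<Longrightarrow> q j \<in> X \<and>
      sees_one_sided (q j) (r j) (Z j) (\<Union>i\<in>F - {j}. Z i) \<and> length (ys j) = 2 * l + 2 \<and>
      set (ys j) \<subseteq> Z j \<and> bulge 1 (q j) (r j) (ys j)" by metis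
  show ?thesis
  proof (rule outward_bulges_cut_off_points[OF assms(3,4)])
    fix j assume j: "j \<in> F"
    show "bulge 1 (q j) (r j) (ys j)" using qry[OF j] by blast
    show "2 * l < length (ys j) \<and> insert (q j) (set (ys j)) \<subseteq> X" using qry[OF j] Z[OF j] by auto
    have "(\<Union>i\<in>F - {j}. set (ys i)) \<subseteq> (\<Union>i\<in>F - {j}. Z i)" using qry by blast
    then show "sees_one_sided (q j) (r j) (set (ys j)) (\<Union>i\<in>F - {j}. set (ys i))"
      using qry[OF j] sees_one_sided_mono by blast
  qed
qed

end

section \<open>Clusters along the moment curve\<close>

definition moment_ordered :: "('p \<Rightarrow> 'p \<Rightarrow> 'p \<Rightarrow> 'p \<Rightarrow> real) \<Rightarrow> nat set \<Rightarrow> (nat \<Rightarrow> 'p) \<Rightarrow> bool" where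
  "moment_ordered ori S f \<longleftrightarrow> (\<forall>a\<in>S. \<forall>b\<in>S. \<forall>c\<in>S. \<forall>d\<in>S. a < b \<longrightarrow> b < c \<longrightarrow> c < d \<longrightarrow>
     0 < ori (f a) (f b) (f c) (f d))"

text \<open>The sign of a Vandermonde determinant.\<close>
definition position_sign :: "nat \<Rightarrow> nat \<Rightarrow> nat \<Rightarrow> nat \<Rightarrow> real" where
  "position_sign a b c d = sgn (real b - real a) * sgn (real c - real a) * sgn (real d - real a) *
     sgn (real c - real b) * sgn (real d - real b) * sgn (real d - real c)"

lemma position_sign_swap:
  "position_sign b a c d = - position_sign a b c d"
  "position_sign a c b d = - position_sign a b c d"
  "position_sign a b d c = - position_sign a b c d"
proof -
  have "sgn (real x - real y) = - sgn (real y - real x)" for x y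
    by (simp flip: sgn_minus)
  from this[of a b] this[of b c] this[of c d] show
    "position_sign b a c d = - position_sign a b c d"
    "position_sign a c b d = - position_sign a b c d"
    "position_sign a b d c = - position_sign a b c d"
    by (simp_all add: position_sign_def)
qed

lemma position_sign_sorted: "a < b \<Longrightarrow> b < c \<Longrightarrow> c < d \<Longrightarrow> position_sign a b c d = 1"
  by (simp add: position_sign_def)

lemma position_sign_nonzero: "distinct [a, b, c, d] \<Longrightarrow> position_sign a b c d \<noteq> 0"
  by (auto simp: position_sign_def sgn_zero_iff)

lemma position_sign_Suc:
  assumes "t' = Suc t" "{a, b, c} \<inter> {t, t'} = {}"
  shows "position_sign a b c t' = position_sign a b c t"
    and "position_sign a b t' c = position_sign a b t c"
proof -
  have "sgn (real t' - real x) = sgn (real t - real x)" if "x \<notin> {t, t'}" for x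
    using that assms(1) by (cases "x < t") auto
  then show "position_sign a b c t' = position_sign a b c t"
    using assms(2) unfolding position_sign_def by simp
  then show "position_sign a b t' c = position_sign a b t c"
    using position_sign_swap(3)[of a b c] by simp
qed

text \<open>In the projection from the line through the points at positions \<open>a\<close> and \<open>b\<close> of the moment curve,
  the point at position \<open>t\<close> lies in the cone spanned by those at positions \<open>l\<close> and \<open>r\<close>.\<close>
definition position_between :: "nat \<Rightarrow> nat \<Rightarrow> nat \<Rightarrow> nat \<Rightarrow> nat \<Rightarrow> bool" where
  "position_between a b l t r \<longleftrightarrow> position_sign a b l t = position_sign a b l r \<and>
     position_sign a b t r = position_sign a b l r"

lemma position_between_first:
  "m < u \<Longrightarrow> u < j \<Longrightarrow> j < w \<Longrightarrow> m < t \<and> t < u \<or> w < t \<Longrightarrow> position_between m j u t w"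
  by (auto simp: position_between_def position_sign_def)

lemma position_between_second:
  "m < u \<Longrightarrow> u < j \<Longrightarrow> j < M \<Longrightarrow> m < t \<and> t < u \<or> j < t \<and> t < M \<Longrightarrow> position_between u j m t M"
  by (auto simp: position_between_def position_sign_def)

lemma distinct_quadruple_induct:
  fixes a b c d :: "'a::linorder"
  assumes "distinct [a, b, c, d]" "{a, b, c, d} \<subseteq> S"
    and swap12: "\<And>a b c d. Q b a c d \<Longrightarrow> Q a b c d"
    and swap23: "\<And>a b c d. Q a c b d \<Longrightarrow> Q a b c d"
    and swap34: "\<And>a b c d. Q a b d c \<Longrightarrow> Q a b c d"
    and sorted: "\<And>a b c d. {a, b, c, d} \<subseteq> S \<Longrightarrow> a < b \<Longrightarrow> b < c \<Longrightarrow> c < d \<Longrightarrow> Q a b c d"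
  shows "Q a b c d"
proof -
  have three_sorted: "Q a b c d"
    if abcd: "{a, b, c, d} \<subseteq> S" "a < b" "b < c" "d \<notin> {a, b, c}" for a b c d
  proof -
    consider "d < a" | "a < d" "d < b" | "b < d" "d < c" | "c < d" using abcd(4) by fastforce
    then show ?thesis
      by cases (use abcd in \<open>auto intro: swap34[OF swap23[OF swap12[OF sorted]]]
        swap34[OF swap23[OF sorted]] swap34[OF sorted] sorted\<close>)
  qed
  have two_sorted: "Q a b c d"
    if abcd: "{a, b, c, d} \<subseteq> S" "a < b" "distinct [a, b, c, d]" for a b c d
  proof -
    consider "c < a" | "a < c" "c < b" | "b < c" using abcd(3) by fastforce
    then show ?thesis
      by cases (use abcd in \<open>auto intro: swap23[OF swap12[OF three_sorted]]
        swap23[OF three_sorted] three_sorted\<close>)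
  qed
  show ?thesis
  proof (cases "a < b")
    case True
    then show ?thesis using assms(1,2) by (intro two_sorted)
  next
    case False
    then have "Q b a c d" using assms(1,2) by (intro two_sorted) auto
    then show ?thesis by (rule swap12)
  qed
qed

lemma (in chirotope) sgn_ori_moment_ordered:
  assumes "moment_ordered ori S f" "{a, b, c, d} \<subseteq> S" "distinct [a, b, c, d]"
  shows "sgn (ori (f a) (f b) (f c) (f d)) = position_sign a b c d"
proof (rule distinct_quadruple_induct[OF assms(3,2)])
  fix a b c d
  show "sgn (ori (f a) (f b) (f c) (f d)) = position_sign a b c d"
    if "sgn (ori (f b) (f a) (f c) (f d)) = position_sign b a c d"
    using that swap12[of "f a" "f b" "f c" "f d"] position_sign_swap(1)[of a b c d]
    by (simp add: sgn_minus)
  show "sgn (ori (f a) (f b) (f c) (f d)) = position_sign a b c d"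
    if "sgn (ori (f a) (f c) (f b) (f d)) = position_sign a c b d"
    using that swap23[of "f a" "f b" "f c" "f d"] position_sign_swap(2)[of a b c d]
    by (simp add: sgn_minus)
  show "sgn (ori (f a) (f b) (f c) (f d)) = position_sign a b c d"
    if "sgn (ori (f a) (f b) (f d) (f c)) = position_sign a b d c"
    using that swap34[of "f a" "f b" "f c" "f d"] position_sign_swap(3)[of a b c d]
    by (simp add: sgn_minus)
  show "sgn (ori (f a) (f b) (f c) (f d)) = position_sign a b c d"
    if "{a, b, c, d} \<subseteq> S" "a < b" "b < c" "c < d"
    using assms(1) that position_sign_sorted by (simp add: moment_ordered_def)
qed

definition single_positions :: "nat \<Rightarrow> nat set" where
  "single_positions K = {t. t \<le> 4 * K \<and> t mod 4 \<noteq> 2}"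

lemma single_positionsI:
  "j \<le> K \<Longrightarrow> 4 * j \<in> single_positions K"
  "j < K \<Longrightarrow> 4 * j + 1 \<in> single_positions K"
  "j < K \<Longrightarrow> 4 * j + 3 \<in> single_positions K"
  by (simp_all add: single_positions_def)

lemma single_positions_neq: "t \<in> single_positions K \<Longrightarrow> t \<noteq> 4 * j + 2"
  unfolding single_positions_def by auto presburger

lemma ex_third_single_position:
  assumes "0 < K"
  shows "\<exists>c\<in>single_positions K. c \<notin> {a, b}"
proof -
  have "{0, 1, 3} \<subseteq> single_positions K" using single_positionsI[of 0 K] assms by auto
  moreover have "\<not> {0, 1, 3} \<subseteq> {a, b}" by auto
  ultimately show ?thesis by blast
qed

text \<open>The positions \<open>0, \<dots>, 4 * K\<close> carry points that are ordered like points on the moment curve: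
  position \<open>4 * j + 2\<close> carries all points of the cluster \<open>C j\<close>, any other position \<open>t\<close> the single
  point \<open>p t\<close>. Only quadruples with at most one cluster point are assumed to be positive.\<close>
locale moment_clusters = chirotope ori
  for ori :: "'p \<Rightarrow> 'p \<Rightarrow> 'p \<Rightarrow> 'p \<Rightarrow> real" +
  fixes X :: "'p set" and K :: nat and p :: "nat \<Rightarrow> 'p" and C :: "nat \<Rightarrow> 'p set"
  assumes finite_X: "finite X"
    and nondegenerate_X: "nondegenerate X"
    and p_in_X: "t \<in> single_positions K \<Longrightarrow> p t \<in> X"
    and C_subset_X: "j < K \<Longrightarrow> C j \<subseteq> X"
    and C_nonempty: "j < K \<Longrightarrow> C j \<noteq> {}"
    and moment_ordered_cluster: "j < K \<Longrightarrow> y \<in> C j \<Longrightarrow>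
      moment_ordered ori (insert (4 * j + 2) (single_positions K)) (p(4 * j + 2 := y))"
begin

lemma sgn_one_cluster:
  assumes "j < K" "y \<in> C j" "{a, b, c} \<subseteq> single_positions K" "distinct [a, b, c]"
  shows "sgn (ori (p a) y (p b) (p c)) = position_sign a (4 * j + 2) b c"
    and "sgn (ori (p a) (p b) y (p c)) = position_sign a b (4 * j + 2) c"
    and "sgn (ori (p a) (p b) (p c) y) = position_sign a b c (4 * j + 2)"
  using sgn_ori_moment_ordered[OF moment_ordered_cluster[OF assms(1,2)], of a "4 * j + 2" b c]
    sgn_ori_moment_ordered[OF moment_ordered_cluster[OF assms(1,2)], of a b "4 * j + 2" c]
    sgn_ori_moment_ordered[OF moment_ordered_cluster[OF assms(1,2)], of a b c "4 * j + 2"]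
    assms(3,4) single_positions_neq[of _ K j]
  by auto

lemma sgn_single_points:
  assumes "0 < K" "{a, b, c, d} \<subseteq> single_positions K" "distinct [a, b, c, d]"
  shows "sgn (ori (p a) (p b) (p c) (p d)) = position_sign a b c d"
proof -
  obtain y where "y \<in> C 0" using C_nonempty[OF assms(1)] by blast
  moreover have "2 \<notin> {a, b, c, d}" using assms(2) by (auto simp: single_positions_def)
  ultimately show ?thesis
    using sgn_ori_moment_ordered[OF moment_ordered_cluster[OF assms(1)], of y a b c d] assms(2,3)
    by (auto simp: numeral_2_eq_2)
qed

lemma cluster_on_one_side:
  assumes "j < K" "{a, b} \<subseteq> single_positions K" "a \<noteq> b"
  shows "\<exists>r \<sigma>. \<sigma> \<noteq> 0 \<and> (\<forall>y\<in>C j. sgn (ori (p a) (p b) r y) = \<sigma>)"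
proof -
  obtain c where c: "c \<in> single_positions K" "c \<notin> {a, b}"
    using ex_third_single_position[of K a b] assms(1) by auto
  have "position_sign a b c (4 * j + 2) \<noteq> 0"
    using assms(2,3) c single_positions_neq[of _ K j] by (intro position_sign_nonzero) auto
  then show ?thesis using sgn_one_cluster(3)[OF assms(1), of _ a b c] assms(2,3) c by auto
qed

lemma single_point_notin_cluster:
  assumes "j < K" "a \<in> single_positions K"
  shows "p a \<notin> C j"
proof
  assume in_C: "p a \<in> C j"
  obtain b where "b \<in> single_positions K" "b \<noteq> a"
    using ex_third_single_position[of K a a] assms(1) by auto
  then obtain r \<sigma> where "\<sigma> \<noteq> 0" "\<forall>y\<in>C j. sgn (ori (p a) (p b) r y) = \<sigma>"
    using cluster_on_one_side[OF assms(1)] assms(2) by blast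
  then show False using in_C by force
qed

lemma strict_axis_order_cluster:
  assumes "j < K" "Z \<subseteq> C j" "{a, b} \<subseteq> single_positions K" "a \<noteq> b"
  shows "strict_axis_order (p a) (p b) Z"
proof -
  obtain r \<sigma> where \<sigma>: "\<sigma> \<noteq> 0" "\<forall>y\<in>C j. sgn (ori (p a) (p b) r y) = \<sigma>"
    using cluster_on_one_side[OF assms(1,3,4)] by blast
  obtain x where "x \<in> C j" using C_nonempty[OF assms(1)] by blast
  then have "p a \<noteq> p b" using \<sigma> swap12[of "p a" "p a" r x] by force
  show ?thesis
  proof (rule strict_axis_orderI)
    fix y z assume yz: "y \<in> Z" "z \<in> Z"
    then show "sgn (ori (p a) (p b) r y) = sgn (ori (p a) (p b) r z)"
      using \<sigma>(2) assms(2) by (metis subsetD)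
    show "ori (p a) (p b) r z \<noteq> 0" using \<sigma> yz(2) assms(2) by force
    assume "y \<noteq> z"
    then have "distinct [p a, p b, y, z]"
      using yz assms single_point_notin_cluster \<open>p a \<noteq> p b\<close> by auto
    moreover have "{p a, p b, y, z} \<subseteq> X" using yz assms p_in_X C_subset_X by blast
    ultimately show "ori (p a) (p b) y z \<noteq> 0"
      using nondegenerate_X unfolding nondegenerate_def by blast
  qed
qed

text \<open>The points of a cluster lie between its two neighbours, as seen along any line through two other
  single points, so the sign of a quadruple with two cluster points is interpolated from those with
  one.\<close>
lemma sgn_two_clusters:
  assumes ij: "i < K" "j < K" "i \<noteq> j" "x \<in> C i" "y \<in> C j"
    and ab: "{a, b} \<subseteq> single_positions K" "a \<noteq> b" "{a, b} \<inter> {4 * i + 1, 4 * i + 3} = {}"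
  shows "sgn (ori (p a) y (p b) x) = position_sign a (4 * j + 2) b (4 * i + 2)"
    and "sgn (ori (p a) y x (p b)) = position_sign a (4 * j + 2) (4 * i + 2) b"
proof -
  let ?l = "4 * i + 1" and ?t = "4 * i + 2" and ?r = "4 * i + 3" and ?s = "4 * j + 2"
  have singles: "{a, b, ?l, ?r} \<subseteq> single_positions K"
    using ab(1) single_positionsI ij(1) by simp
  have distinct: "distinct [a, b, ?l, ?t, ?r, ?s]"
    using ab single_positions_neq[of _ K i] single_positions_neq[of _ K j] ij(3) by auto
  have shift: "position_sign a b ?l ?r = position_sign a b ?l ?t"
    "position_sign a b ?t ?r = position_sign a b ?l ?r"
    "position_sign a b ?r ?s = position_sign a b ?t ?s"
    "position_sign a b ?t ?s = position_sign a b ?l ?s"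
    using position_sign_Suc(1)[of ?r ?t a b ?l] position_sign_Suc(2)[of ?t ?l a b ?r]
      position_sign_Suc(2)[of ?r ?t a b ?s] position_sign_Suc(2)[of ?t ?l a b ?s] distinct
    by auto
  have near: "sgn (ori (p a) (p b) (p ?l) x) = position_sign a b ?l ?r"
    "sgn (ori (p a) (p b) x (p ?r)) = position_sign a b ?l ?r"
    using sgn_one_cluster(3)[OF ij(1,4), of a b ?l] sgn_one_cluster(2)[OF ij(1,4), of a b ?r]
      singles distinct shift by auto
  have far: "sgn (ori (p a) (p b) (p ?l) y) = position_sign a b ?t ?s"
    "sgn (ori (p a) (p b) (p ?r) y) = position_sign a b ?t ?s"
    using sgn_one_cluster(3)[OF ij(2,5), of a b ?l] sgn_one_cluster(3)[OF ij(2,5), of a b ?r]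
      singles distinct shift by auto
  have neighbours: "sgn (ori (p a) (p b) (p ?l) (p ?r)) = position_sign a b ?l ?r"
    using sgn_single_points[of a b ?l ?r] singles distinct ij(1) by auto
  then have nonzero: "ori (p a) (p b) (p ?l) (p ?r) \<noteq> 0"
    using position_sign_nonzero[of a b ?l ?r] distinct by force
  have "sgn (ori (p a) (p b) x y) = sgn (ori (p a) (p b) (p ?l) y)"
    by (rule sgn_ori_interpolate[OF nonzero]) (simp_all only: near far neighbours)
  then have "sgn (ori (p a) (p b) x y) = position_sign a b ?t ?s" by (simp only: far)
  then show "sgn (ori (p a) y (p b) x) = position_sign a ?s b ?t"
    unfolding ori_rotate[of "p a" "p b" x y, symmetric] position_sign_swap(2)[of a b ?s ?t]
      position_sign_swap(3)[of a b ?t ?s] by simp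
  then show "sgn (ori (p a) y x (p b)) = position_sign a ?s ?t b"
    using swap34[of "p a" y x "p b"] position_sign_swap(3)[of a ?s ?t b] by (simp add: sgn_minus)
qed

lemma sees_clusters_one_sided:
  assumes j: "j < K" "Z \<subseteq> C j"
    and qlr: "{q, l, r} \<subseteq> single_positions K" "distinct [q, l, r]"
    and agree: "axes_agree (p q) (p l) (p q) (p r) Z"
    and F: "\<And>i. i \<in> F \<Longrightarrow> i < K \<and> i \<noteq> j \<and> {q, l, r} \<inter> {4 * i + 1, 4 * i + 3} = {} \<and>
      position_between q (4 * j + 2) l (4 * i + 2) r"
  shows "sees_one_sided (p q) (p l) Z (\<Union>i\<in>F. C i)"
  unfolding sees_one_sided_def
proof (intro conjI ballI impI)
  show "strict_axis_order (p q) (p l) Z" using strict_axis_order_cluster[OF j] qlr by simp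
  fix y z x assume yz: "y \<in> Z" "z \<in> Z" "axis_less (p q) (p l) y z" and "x \<in> (\<Union>i\<in>F. C i)"
  then obtain i where i: "i \<in> F" "x \<in> C i" by blast
  have y: "y \<in> C j" using yz(1) j(2) by blast
  have lr: "sgn (ori (p q) y (p l) (p r)) = position_sign q (4 * j + 2) l r"
    using sgn_one_cluster(1)[OF j(1) y qlr] .
  then have "ori (p q) y (p l) (p r) \<noteq> 0"
    using position_sign_nonzero[of q "4 * j + 2" l r] qlr single_positions_neq[of _ K j] by force
  moreover have "sgn (ori (p q) y (p l) x) = sgn (ori (p q) y (p l) (p r))"
    "sgn (ori (p q) y x (p r)) = sgn (ori (p q) y (p l) (p r))"
    using sgn_two_clusters(1)[of i j x y q l] sgn_two_clusters(2)[of i j x y q r]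
      F[OF i(1)] i(2) y j qlr lr
    by (auto simp: position_between_def)
  moreover have "sgn (ori (p q) y (p l) z) = sgn (ori (p q) y (p r) z)"
    using axes_agree_sgn[OF agree yz(1,2)] swap23[of "p q" "p l" y z] swap23[of "p q" "p r" y z]
    by (simp add: sgn_minus)
  ultimately have "sgn (ori (p q) y x z) = sgn (ori (p q) y (p l) z)"
    by (rule sgn_ori_interpolate)
  then have "sgn (ori (p q) x y z) = sgn (ori (p q) (p l) y z)"
    using swap23[of "p q" x y z] swap23[of "p q" "p l" y z] by (simp add: sgn_minus)
  then show "0 < ori (p q) x y z" using yz(3) by (simp add: axis_less_def sgn_1_pos)
qed

text \<open>By the agreement assumption, the direction of any two points of \<open>Z\<close> avoids the cone spanned by
  \<open>m\<close>, \<open>u\<close>, \<open>w\<close>, \<open>M\<close>, which contains all other clusters. The sign with respect to the axis \<open>m u\<close>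
  decides whether the separating planes pass through \<open>m\<close> or through \<open>u\<close>.\<close>
lemma ex_one_sided_subcluster:
  assumes j: "j < K" "Z \<subseteq> C j" "s * s \<le> card Z"
    and pos: "{m, u, w, M} \<subseteq> single_positions K" "m < u" "u < 4 * j + 2" "4 * j + 2 < w" "w \<le> M"
    and agree: "axes_agree (p u) (p M) (p m) (p w) Z"
    and F: "\<And>i. i \<in> F \<Longrightarrow> m < 4 * i + 1 \<and> 4 * i + 3 < u \<or> w < 4 * i + 1 \<and> 4 * i + 3 < M"
  shows "\<exists>Z' q r. Z' \<subseteq> C j \<and> card Z' = s \<and> q \<in> X - Z' \<and> sees_one_sided q r Z' (\<Union>i\<in>F. C i)"
proof -
  have order: "strict_axis_order (p m) (p u) Z" "strict_axis_order (p m) (p w) Z"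
    using strict_axis_order_cluster[OF j(1,2)] pos by auto
  have "finite Z" using finite_X C_subset_X j finite_subset by meson
  have "M \<le> 4 * K" using pos(1) by (simp add: single_positions_def)
  have apart: "i < K \<and> i \<noteq> j \<and> {m, u, w, M} \<inter> {4 * i + 1, 4 * i + 3} = {}" if "i \<in> F" for i
    using F[OF that] pos(2-5) \<open>M \<le> 4 * K\<close> by auto
  have between: "position_between m (4 * j + 2) u (4 * i + 2) w"
      "position_between u (4 * j + 2) m (4 * i + 2) M"
    if "i \<in> F" for i
    using F[OF that] pos by (intro position_between_first position_between_second; linarith)+
  have center: "p q \<in> X - Z'" if "q \<in> single_positions K" "Z' \<subseteq> Z" for q Z'
    using p_in_X single_point_notin_cluster j(1,2) that by blast
  consider (from_m) Z' where "Z' \<subseteq> Z" "card Z' = s" "axes_agree (p m) (p u) (p m) (p w) Z'"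
    | (from_u) Z' where "Z' \<subseteq> Z" "card Z' = s" "axes_agree (p u) (p m) (p m) (p w) Z'"
    using axis_orders_split[OF \<open>finite Z\<close> j(3) order] by blast
  then show ?thesis
  proof cases
    case from_m
    have "sees_one_sided (p m) (p u) Z' (\<Union>i\<in>F. C i)"
      by (rule sees_clusters_one_sided[OF j(1) _ _ _ from_m(3)])
        (use from_m j pos apart between in auto)
    then show ?thesis using from_m j(2) center[of m] pos(1) by blast
  next
    case from_u
    have agree': "axes_agree (p u) (p m) (p u) (p M) Z'"
      using axes_agree_trans[OF from_u(3) axes_agree_sym[OF axes_agree_subset[OF agree from_u(1)]]] .
    have "sees_one_sided (p u) (p m) Z' (\<Union>i\<in>F. C i)"
      by (rule sees_clusters_one_sided[OF j(1) _ _ _ agree'])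
        (use from_u j pos apart between in auto)
    then show ?thesis using from_u j(2) center[of u] pos(1) by blast
  qed
qed

definition separated_clusters :: "nat \<Rightarrow> nat set \<Rightarrow> bool" where
  "separated_clusters s F \<longleftrightarrow> F \<subseteq> {..<K} \<and> (\<forall>j\<in>F. \<exists>Z q r. Z \<subseteq> C j \<and> card Z = s \<and> q \<in> X - Z \<and>
     sees_one_sided q r Z (\<Union>i\<in>F - {j}. C i))"

lemma separated_clusters_cut_off_points:
  assumes "separated_clusters s F" "n \<le> card F * l" "(2 * n + 2 * l choose (2 * l)) < s"
  shows "cut_off_points X n"
proof -
  have F: "F \<subseteq> {..<K}" "finite F"
    using assms(1) finite_subset unfolding separated_clusters_def by blast+
  obtain Z where Z: "\<And>j. j \<in> F \<Longrightarrow> Z j \<subseteq> C j \<and> card (Z j) = s \<and>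
      (\<exists>q r. q \<in> X - Z j \<and> sees_one_sided q r (Z j) (\<Union>i\<in>F - {j}. C i))"
    using assms(1) unfolding separated_clusters_def by metis
  show ?thesis
  proof (rule one_sided_clusters_cut_off_points[OF finite_X nondegenerate_X F(2) assms(2), of Z])
    fix j assume j: "j \<in> F"
    show "Z j \<subseteq> X \<and> (2 * n + 2 * l choose (2 * l)) < card (Z j)"
      using Z[OF j] C_subset_X F(1) j assms(3) by blast
    have "(\<Union>i\<in>F - {j}. Z i) \<subseteq> (\<Union>i\<in>F - {j}. C i)" using Z by blast
    then show "\<exists>q r. q \<in> X - Z j \<and> sees_one_sided q r (Z j) (\<Union>i\<in>F - {j}. Z i)"
      using Z[OF j] sees_one_sided_mono by blast
  qed
qed

end

section \<open>The query game\<close>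

text \<open>The set \<open>F\<close> has one element in each of \<open>k\<close> consecutive blocks of length \<open>m\<close>, and \<open>b\<close> is the end
  of the block of \<open>j\<close>.\<close>
lemma block_transversal:
  fixes \<alpha> m :: nat
  shows "(\<exists>F\<subseteq>{\<alpha>..<\<alpha> + k * m}. card F = k \<and>
      (\<forall>j\<in>F. \<exists>b. j < b \<and> b \<le> \<alpha> + k * m \<and> (\<forall>i\<in>F. j < i \<longrightarrow> b \<le> i) \<and> Q j b)) \<or>
    (\<exists>\<beta>\<ge>\<alpha>. \<beta> + m \<le> \<alpha> + k * m \<and> (\<forall>j\<in>{\<beta>..<\<beta> + m}. \<not> Q j (\<beta> + m)))"
proof (induction k)
  case (Suc k)
  let ?\<beta> = "\<alpha> + k * m"
  consider (transversal) F j where "F \<subseteq> {\<alpha>..<?\<beta>}" "card F = k" "j \<in> {?\<beta>..<?\<beta> + m}" "Q j (?\<beta> + m)"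
      "\<forall>j\<in>F. \<exists>b. j < b \<and> b \<le> ?\<beta> \<and> (\<forall>i\<in>F. j < i \<longrightarrow> b \<le> i) \<and> Q j b"
    | (earlier) \<beta> where "\<alpha> \<le> \<beta>" "\<beta> + m \<le> ?\<beta>" "\<forall>j\<in>{\<beta>..<\<beta> + m}. \<not> Q j (\<beta> + m)"
    | (last) "\<forall>j\<in>{?\<beta>..<?\<beta> + m}. \<not> Q j (?\<beta> + m)"
    using Suc.IH by blast
  then show ?case
  proof cases
    case transversal
    have finF: "finite F" using transversal(1) finite_subset by blast
    have "\<exists>b. j' < b \<and> b \<le> \<alpha> + Suc k * m \<and> (\<forall>i\<in>insert j F. j' < i \<longrightarrow> b \<le> i) \<and> Q j' b"
      if "j' \<in> insert j F" for j'
    proof (cases "j' = j")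
      case True
      have "\<not> j < i" if "i \<in> insert j F" for i using that transversal(1,3) by force
      then show ?thesis using transversal(3,4) True by (intro exI[of _ "?\<beta> + m"]) auto
    next
      case False
      then have "j' \<in> F" using that by simp
      then obtain b where "j' < b" "b \<le> ?\<beta>" "\<forall>i\<in>F. j' < i \<longrightarrow> b \<le> i" "Q j' b"
        using transversal(5) by blast
      then show ?thesis using transversal(3) by (intro exI[of _ b]) auto
    qed
    moreover have "card (insert j F) = Suc k"
      using transversal(1-3) finF by (subst card_insert_disjoint) auto
    moreover have "insert j F \<subseteq> {\<alpha>..<\<alpha> + Suc k * m}" using transversal(1,3) by auto
    ultimately show ?thesis by blast
  next
    case earlier
    then show ?thesis by (intro disjI2 exI[of _ \<beta>]) auto
  next
    case last
    then show ?thesis by (intro disjI2 exI[of _ ?\<beta>]) auto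
  qed
qed auto

fun stage_size :: "nat \<Rightarrow> nat \<Rightarrow> nat" where
  "stage_size k 0 = 0"
| "stage_size k (Suc r) = Suc (k * stage_size k r)"

context moment_clusters
begin

text \<open>Pairs of points of the cluster \<open>j\<close> are compared by the signs with respect to two fixed axes: one
  joins the right end \<open>4 * K\<close> to the left neighbour of the cluster, the other joins the left end \<open>0\<close>
  to its right neighbour. If they agree, the cluster is separated from all others. If they disagree,
  the axis joining the single points \<open>4 * a\<close> and \<open>4 * b\<close>, where \<open>a \<le> j < b\<close>, agrees with one of them:
  if with the first, the cluster is separated from the clusters \<open>a, \<dots>, j - 1\<close> and \<open>b, \<dots>, K - 1\<close>, if
  with the second, from the clusters \<open>0, \<dots>, a - 1\<close> and \<open>j + 1, \<dots>, b - 1\<close>.\<close>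
definition neighbours_agree :: "nat \<Rightarrow> 'p set \<Rightarrow> bool" where
  "neighbours_agree j Z \<longleftrightarrow> axes_agree (p (4 * j + 1)) (p (4 * K)) (p 0) (p (4 * j + 3)) Z"

definition neighbours_disagree :: "nat \<Rightarrow> 'p set \<Rightarrow> bool" where
  "neighbours_disagree j Z \<longleftrightarrow> axes_agree (p (4 * K)) (p (4 * j + 1)) (p 0) (p (4 * j + 3)) Z"

definition agrees_with_right :: "nat \<Rightarrow> nat \<Rightarrow> nat \<Rightarrow> 'p set \<Rightarrow> bool" where
  "agrees_with_right a b j Z \<longleftrightarrow> axes_agree (p (4 * j + 1)) (p (4 * K)) (p (4 * a)) (p (4 * b)) Z"

definition agrees_with_left :: "nat \<Rightarrow> nat \<Rightarrow> nat \<Rightarrow> 'p set \<Rightarrow> bool" where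
  "agrees_with_left a b j Z \<longleftrightarrow> axes_agree (p (4 * a)) (p (4 * b)) (p 0) (p (4 * j + 3)) Z"

lemma finite_subcluster: "j < K \<Longrightarrow> Z \<subseteq> C j \<Longrightarrow> finite Z"
  using finite_X C_subset_X finite_subset by meson

lemma neighbours_split:
  assumes "j < K" "s * t \<le> card (C j)"
  shows "(\<exists>Z\<subseteq>C j. card Z = s \<and> neighbours_agree j Z) \<or> (\<exists>Z\<subseteq>C j. card Z = t \<and> neighbours_disagree j Z)"
  unfolding neighbours_agree_def neighbours_disagree_def
  using assms single_positionsI[of j K] single_positionsI[of 0 K] single_positionsI[of K K]
  by (intro axis_orders_split finite_subcluster strict_axis_order_cluster) auto

lemma query_split:
  assumes "j < K" "Z \<subseteq> C j" "neighbours_disagree j Z" "a \<le> j" "j < b" "b \<le> K" "s * t \<le> card Z"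
  shows "(\<exists>Z'\<subseteq>Z. card Z' = s \<and> agrees_with_right a b j Z') \<or>
    (\<exists>Z'\<subseteq>Z. card Z' = t \<and> agrees_with_left a b j Z')"
proof -
  have "(\<exists>Z'\<subseteq>Z. card Z' = s \<and> axes_agree (p (4 * j + 1)) (p (4 * K)) (p (4 * a)) (p (4 * b)) Z') \<or>
      (\<exists>Z'\<subseteq>Z. card Z' = t \<and> axes_agree (p (4 * K)) (p (4 * j + 1)) (p (4 * a)) (p (4 * b)) Z')"
    using assms single_positionsI[of j K] single_positionsI[of a K]
      single_positionsI[of b K] single_positionsI[of K K]
    by (intro axis_orders_split finite_subcluster strict_axis_order_cluster) auto
  moreover have "agrees_with_left a b j Z'"
    if "Z' \<subseteq> Z" "axes_agree (p (4 * K)) (p (4 * j + 1)) (p (4 * a)) (p (4 * b)) Z'" for Z'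
    using axes_agree_trans[OF axes_agree_sym[OF that(2)] axes_agree_subset[OF _ that(1)]] assms(3)
    unfolding agrees_with_left_def neighbours_disagree_def by blast
  ultimately show ?thesis unfolding agrees_with_right_def by blast
qed

lemma separated_clusters_if_neighbours_agree:
  assumes "F \<subseteq> {..<K}" "\<And>j. j \<in> F \<Longrightarrow> \<exists>Z\<subseteq>C j. s * s \<le> card Z \<and> neighbours_agree j Z"
  shows "separated_clusters s F"
  unfolding separated_clusters_def
proof (intro conjI ballI)
  fix j assume j: "j \<in> F"
  then have "j < K" using assms(1) by blast
  obtain Z where Z: "Z \<subseteq> C j" "s * s \<le> card Z" "neighbours_agree j Z" using assms(2)[OF j] by blast
  have "0 < 4 * i + 1 \<and> 4 * i + 3 < 4 * j + 1 \<or> 4 * j + 3 < 4 * i + 1 \<and> 4 * i + 3 < 4 * K"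
    if "i \<in> F - {j}" for i
    using that assms(1) by auto
  then show "\<exists>Z q r. Z \<subseteq> C j \<and> card Z = s \<and> q \<in> X - Z \<and> sees_one_sided q r Z (\<Union>i\<in>F - {j}. C i)"
    using Z(3) \<open>j < K\<close> single_positionsI[of j K] single_positionsI[of 0 K] single_positionsI[of K K]
    unfolding neighbours_agree_def
    by (intro ex_one_sided_subcluster[OF \<open>j < K\<close> Z(1,2), of 0 "4 * j + 1" "4 * j + 3" "4 * K"]) auto
qed (fact assms(1))

lemma separated_clusters_if_agree_with_right:
  assumes "F \<subseteq> {a..<K}"
    and "\<And>j. j \<in> F \<Longrightarrow> \<exists>Z b. Z \<subseteq> C j \<and> s * s \<le> card Z \<and> j < b \<and> b \<le> K \<and> (\<forall>i\<in>F. j < i \<longrightarrow> b \<le> i) \<and>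
      agrees_with_right a b j Z"
  shows "separated_clusters s F"
  unfolding separated_clusters_def
proof (intro conjI ballI)
  fix j assume j: "j \<in> F"
  then have "a \<le> j" "j < K" using assms(1) by auto
  obtain Z b where Z: "Z \<subseteq> C j" "s * s \<le> card Z" "agrees_with_right a b j Z"
    and b: "j < b" "b \<le> K" "\<forall>i\<in>F. j < i \<longrightarrow> b \<le> i"
    using assms(2)[OF j] by blast
  have "4 * a < 4 * i + 1 \<and> 4 * i + 3 < 4 * j + 1 \<or> 4 * b < 4 * i + 1 \<and> 4 * i + 3 < 4 * K"
    if "i \<in> F - {j}" for i
    using that assms(1) b(3) by (cases i j rule: linorder_cases) auto
  then show "\<exists>Z q r. Z \<subseteq> C j \<and> card Z = s \<and> q \<in> X - Z \<and> sees_one_sided q r Z (\<Union>i\<in>F - {j}. C i)"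
    using Z(3) b \<open>a \<le> j\<close> \<open>j < K\<close> single_positionsI[of j K] single_positionsI[of a K]
      single_positionsI[of b K] single_positionsI[of K K] unfolding agrees_with_right_def
    by (intro ex_one_sided_subcluster[OF \<open>j < K\<close> Z(1,2), of "4 * a" "4 * j + 1" "4 * b" "4 * K"]) auto
qed (use assms(1) in auto)

definition nested_left_agreement :: "nat \<Rightarrow> nat \<Rightarrow> nat set \<Rightarrow> bool" where
  "nested_left_agreement e u F \<longleftrightarrow> (\<forall>j\<in>F. \<exists>Z a b. Z \<subseteq> C j \<and> e \<le> card Z \<and> u \<le> a \<and> a \<le> j \<and> b \<le> K \<and>
     (\<forall>i\<in>F. i < b \<and> (i < j \<longrightarrow> i < a)) \<and> agrees_with_left a b j Z)"

lemma nested_left_agreement_insert: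
  assumes F: "nested_left_agreement e (Suc \<alpha>) F" "F \<subseteq> {\<alpha><..<b}"
    and \<alpha>: "u \<le> \<alpha>" "\<alpha> < b" "b \<le> K" "Z \<subseteq> C \<alpha>" "e \<le> card Z" "agrees_with_left u b \<alpha> Z"
  shows "nested_left_agreement e u (insert \<alpha> F)"
  unfolding nested_left_agreement_def
proof
  fix j assume j: "j \<in> insert \<alpha> F"
  show "\<exists>Z a b. Z \<subseteq> C j \<and> e \<le> card Z \<and> u \<le> a \<and> a \<le> j \<and> b \<le> K \<and>
     (\<forall>i\<in>insert \<alpha> F. i < b \<and> (i < j \<longrightarrow> i < a)) \<and> agrees_with_left a b j Z"
  proof (cases "j = \<alpha>")
    case True
    then show ?thesis using \<alpha> F(2) by (intro exI[of _ Z] exI[of _ u] exI[of _ b]) auto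
  next
    case False
    then have "j \<in> F" using j by simp
    then obtain Z' a b' where Z': "Z' \<subseteq> C j" "e \<le> card Z'" "agrees_with_left a b' j Z'"
      and ab': "Suc \<alpha> \<le> a" "a \<le> j" "b' \<le> K" "\<forall>i\<in>F. i < b' \<and> (i < j \<longrightarrow> i < a)"
      using F(1) unfolding nested_left_agreement_def by blast
    then have "\<forall>i\<in>insert \<alpha> F. i < b' \<and> (i < j \<longrightarrow> i < a)" using \<open>j \<in> F\<close> by fastforce
    moreover have "u \<le> a" using ab'(1) \<alpha>(1) by simp
    ultimately show ?thesis using Z' ab'(2,3) by blast
  qed
qed

lemma separated_clusters_if_nested_left_agreement:
  assumes "nested_left_agreement (s * s) u F" "0 < u"
  shows "separated_clusters s F"
  unfolding separated_clusters_def
proof (intro conjI ballI)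
  show "F \<subseteq> {..<K}" using assms(1) unfolding nested_left_agreement_def by fastforce
  fix j assume j: "j \<in> F"
  then obtain Z a b where Z: "Z \<subseteq> C j" "s * s \<le> card Z" "agrees_with_left a b j Z"
    and ab: "u \<le> a" "a \<le> j" "b \<le> K" "\<forall>i\<in>F. i < b \<and> (i < j \<longrightarrow> i < a)"
    using assms(1) unfolding nested_left_agreement_def by blast
  then have "j < b" "j < K" using j by auto
  have "0 < 4 * i + 1 \<and> 4 * i + 3 < 4 * a \<or> 4 * j + 3 < 4 * i + 1 \<and> 4 * i + 3 < 4 * b"
    if "i \<in> F - {j}" for i
    using that ab(4) by (cases i j rule: linorder_cases) auto
  then show "\<exists>Z q r. Z \<subseteq> C j \<and> card Z = s \<and> q \<in> X - Z \<and> sees_one_sided q r Z (\<Union>i\<in>F - {j}. C i)"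
    using Z(3) ab assms(2) \<open>j < K\<close> \<open>j < b\<close> single_positionsI[of j K] single_positionsI[of a K]
      single_positionsI[of b K] single_positionsI[of 0 K] unfolding agrees_with_left_def
    by (intro ex_one_sided_subcluster[OF \<open>j < K\<close> Z(1,2), of 0 "4 * a" "4 * j + 3" "4 * b"]) auto
qed

definition has_separated_clusters :: "nat \<Rightarrow> nat \<Rightarrow> bool" where
  "has_separated_clusters n s \<longleftrightarrow> (\<exists>F. card F = n \<and> separated_clusters s F)"

definition disagreeing_subclusters :: "nat set \<Rightarrow> nat \<Rightarrow> (nat \<Rightarrow> 'p set) \<Rightarrow> bool" where
  "disagreeing_subclusters J t Z \<longleftrightarrow> (\<forall>j\<in>J. Z j \<subseteq> C j \<and> neighbours_disagree j (Z j) \<and> t \<le> card (Z j))"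

lemma opening_round:
  assumes "\<alpha> + k * m \<le> K" "\<And>j. j < K \<Longrightarrow> (s * s) * t \<le> card (C j)"
  shows "has_separated_clusters k s \<or>
    (\<exists>\<beta> Z. \<alpha> \<le> \<beta> \<and> \<beta> + m \<le> K \<and> disagreeing_subclusters {\<beta>..<\<beta> + m} t Z)"
proof -
  let ?Q = "\<lambda>j _. \<exists>Z\<subseteq>C j. card Z = s * s \<and> neighbours_agree j Z"
  consider (agree) F where "F \<subseteq> {\<alpha>..<\<alpha> + k * m}" "card F = k" "\<forall>j\<in>F. ?Q j 0"
    | (disagree) \<beta> where "\<alpha> \<le> \<beta>" "\<beta> + m \<le> \<alpha> + k * m" "\<forall>j\<in>{\<beta>..<\<beta> + m}. \<not> ?Q j 0"
    using block_transversal[of \<alpha> k m ?Q] by blast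
  then show ?thesis
  proof cases
    case agree
    have "separated_clusters s F"
    proof (rule separated_clusters_if_neighbours_agree)
      show "F \<subseteq> {..<K}" using agree(1) assms(1) by fastforce
      fix j assume "j \<in> F"
      then obtain Z where "Z \<subseteq> C j" "card Z = s * s" "neighbours_agree j Z" using agree(3) by blast
      then show "\<exists>Z\<subseteq>C j. s * s \<le> card Z \<and> neighbours_agree j Z" by auto
    qed
    then show ?thesis using agree(2) unfolding has_separated_clusters_def by blast
  next
    case disagree
    have "\<exists>Z\<subseteq>C j. card Z = t \<and> neighbours_disagree j Z" if j: "j \<in> {\<beta>..<\<beta> + m}" for j
    proof -
      have "j < K" using disagree(2) assms(1) j by simp
      then show ?thesis using neighbours_split[OF _ assms(2)] disagree(3) j by blast
    qed
    then obtain Z where "\<forall>j\<in>{\<beta>..<\<beta> + m}. Z j \<subseteq> C j \<and> card (Z j) = t \<and> neighbours_disagree j (Z j)"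
      by metis
    then have "disagreeing_subclusters {\<beta>..<\<beta> + m} t Z" by (simp add: disagreeing_subclusters_def)
    then show ?thesis using disagree(1,2) assms(1) by (meson le_trans)
  qed
qed

lemma query_round:
  assumes "\<alpha> + k * m \<le> K" and Z: "disagreeing_subclusters {\<alpha>..<\<alpha> + k * m} ((s * s) * t) Z"
  shows "has_separated_clusters k s \<or>
    (\<exists>\<beta> Z'. \<alpha> \<le> \<beta> \<and> \<beta> + m \<le> \<alpha> + k * m \<and> disagreeing_subclusters {\<beta>..<\<beta> + m} t Z' \<and>
      (\<forall>j\<in>{\<beta>..<\<beta> + m}. agrees_with_left \<alpha> (\<beta> + m) j (Z' j)))"
proof -
  let ?Q = "\<lambda>j b. \<exists>Z'\<subseteq>Z j. card Z' = s * s \<and> agrees_with_right \<alpha> b j Z'"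
  consider (right) F where "F \<subseteq> {\<alpha>..<\<alpha> + k * m}" "card F = k"
      "\<forall>j\<in>F. \<exists>b. j < b \<and> b \<le> \<alpha> + k * m \<and> (\<forall>i\<in>F. j < i \<longrightarrow> b \<le> i) \<and> ?Q j b"
    | (left) \<beta> where "\<alpha> \<le> \<beta>" "\<beta> + m \<le> \<alpha> + k * m" "\<forall>j\<in>{\<beta>..<\<beta> + m}. \<not> ?Q j (\<beta> + m)"
    using block_transversal[of \<alpha> k m ?Q] by blast
  then show ?thesis
  proof cases
    case right
    have "separated_clusters s F"
    proof (rule separated_clusters_if_agree_with_right)
      show "F \<subseteq> {\<alpha>..<K}" using right(1) assms(1) by fastforce
      fix j assume j: "j \<in> F"
      then obtain b Z' where b: "j < b" "b \<le> \<alpha> + k * m" "\<forall>i\<in>F. j < i \<longrightarrow> b \<le> i"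
        and Z': "Z' \<subseteq> Z j" "card Z' = s * s" "agrees_with_right \<alpha> b j Z'"
        using right(3) by blast
      have "Z' \<subseteq> C j" using Z Z'(1) right(1) j unfolding disagreeing_subclusters_def by blast
      then show "\<exists>Z b. Z \<subseteq> C j \<and> s * s \<le> card Z \<and> j < b \<and> b \<le> K \<and>
          (\<forall>i\<in>F. j < i \<longrightarrow> b \<le> i) \<and> agrees_with_right \<alpha> b j Z"
        using b Z' assms(1) by (intro exI[of _ Z'] exI[of _ b]) auto
    qed
    then show ?thesis using right(2) unfolding has_separated_clusters_def by blast
  next
    case left
    have "\<exists>Z'. Z' \<subseteq> C j \<and> neighbours_disagree j Z' \<and> t \<le> card Z' \<and> agrees_with_left \<alpha> (\<beta> + m) j Z'"
      if j: "j \<in> {\<beta>..<\<beta> + m}" for j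
    proof -
      have Zj: "Z j \<subseteq> C j" "neighbours_disagree j (Z j)" "(s * s) * t \<le> card (Z j)"
        using Z left(1,2) j unfolding disagreeing_subclusters_def by auto
      moreover have "\<alpha> \<le> j" "j < \<beta> + m" "\<beta> + m \<le> K" "j < K" using left(1,2) j assms(1) by auto
      ultimately obtain Z' where "Z' \<subseteq> Z j" "card Z' = t" "agrees_with_left \<alpha> (\<beta> + m) j Z'"
        using query_split[of j "Z j" \<alpha> "\<beta> + m" "s * s" t] left(3) j by blast
      moreover from this have "neighbours_disagree j Z'"
        using Zj(2) axes_agree_subset unfolding neighbours_disagree_def by blast
      ultimately show ?thesis using Zj(1) by blast
    qed
    then obtain Z' where "\<forall>j\<in>{\<beta>..<\<beta> + m}. Z' j \<subseteq> C j \<and> neighbours_disagree j (Z' j) \<and>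
        t \<le> card (Z' j) \<and> agrees_with_left \<alpha> (\<beta> + m) j (Z' j)"
      by metis
    then show ?thesis using left(1,2) unfolding disagreeing_subclusters_def by blast
  qed
qed

lemma query_rounds:
  assumes "u \<le> \<alpha>" "\<alpha> + stage_size k r \<le> b" "b \<le> K" "0 < s"
    and "disagreeing_subclusters {\<alpha>..<\<alpha> + stage_size k r} ((s * s) ^ r * e) Z"
    and "\<forall>j\<in>{\<alpha>..<\<alpha> + stage_size k r}. agrees_with_left u b j (Z j)"
  shows "has_separated_clusters k s \<or>
    (\<exists>F\<subseteq>{\<alpha>..<\<alpha> + stage_size k r}. card F = r \<and> nested_left_agreement e u F)"
  using assms(1-3,5,6)
proof (induction r arbitrary: \<alpha> u b Z)
  case 0
  then show ?case by (auto simp: nested_left_agreement_def intro!: exI[of _ "{}"])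
next
  case (Suc r)
  let ?m = "stage_size k r"
  note Z = Suc.prems(4)[unfolded disagreeing_subclusters_def]
  have "has_separated_clusters k s \<or>
    (\<exists>\<beta> Z'. Suc \<alpha> \<le> \<beta> \<and> \<beta> + ?m \<le> Suc \<alpha> + k * ?m \<and>
      disagreeing_subclusters {\<beta>..<\<beta> + ?m} ((s * s) ^ r * e) Z' \<and>
      (\<forall>j\<in>{\<beta>..<\<beta> + ?m}. agrees_with_left (Suc \<alpha>) (\<beta> + ?m) j (Z' j)))"
    using Suc.prems(2,3) Z
    by (intro query_round[where Z = Z]) (auto simp: mult.assoc disagreeing_subclusters_def)
  then show ?case
  proof (elim disjE exE conjE)
    fix \<beta> Z'
    assume \<beta>: "Suc \<alpha> \<le> \<beta>" "\<beta> + ?m \<le> Suc \<alpha> + k * ?m"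
      and Z': "disagreeing_subclusters {\<beta>..<\<beta> + ?m} ((s * s) ^ r * e) Z'"
        "\<forall>j\<in>{\<beta>..<\<beta> + ?m}. agrees_with_left (Suc \<alpha>) (\<beta> + ?m) j (Z' j)"
    have "nested_left_agreement e u (insert \<alpha> F) \<and> card (insert \<alpha> F) = Suc r \<and>
        insert \<alpha> F \<subseteq> {\<alpha>..<\<alpha> + stage_size k (Suc r)}"
      if F: "F \<subseteq> {\<beta>..<\<beta> + ?m}" "card F = r" "nested_left_agreement e (Suc \<alpha>) F" for F
    proof (intro conjI nested_left_agreement_insert)
      show "nested_left_agreement e (Suc \<alpha>) F" by fact
      show "F \<subseteq> {\<alpha><..<b}" "insert \<alpha> F \<subseteq> {\<alpha>..<\<alpha> + stage_size k (Suc r)}"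
        using F(1) \<beta> Suc.prems(2) by fastforce+
      show "u \<le> \<alpha>" "\<alpha> < b" "b \<le> K" using Suc.prems(1-3) by auto
      show "Z \<alpha> \<subseteq> C \<alpha>" "agrees_with_left u b \<alpha> (Z \<alpha>)" using Z Suc.prems(5) by auto
      have "e \<le> (s * s) ^ Suc r * e" using \<open>0 < s\<close> by simp
      also have "\<dots> \<le> card (Z \<alpha>)" using Z by simp
      finally show "e \<le> card (Z \<alpha>)" .
      have "finite F" "\<alpha> \<notin> F" using F(1) \<beta>(1) finite_subset by fastforce+
      then show "card (insert \<alpha> F) = Suc r" using F(2) by simp
    qed
    moreover have "has_separated_clusters k s \<or>
      (\<exists>F\<subseteq>{\<beta>..<\<beta> + ?m}. card F = r \<and> nested_left_agreement e (Suc \<alpha>) F)"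
      using \<beta> Suc.prems(2,3) Z' by (intro Suc.IH[of "Suc \<alpha>" \<beta> "\<beta> + ?m" Z']) auto
    ultimately show ?thesis by blast
  qed blast
qed

text \<open>The cluster \<open>0\<close> is left out so that the axes queried do not pass through the left end \<open>0\<close>.\<close>
lemma has_separated_clusters_if_large:
  assumes K: "K = Suc (k * (k * stage_size k r))" and "0 < s"
    and size: "\<And>j. j < K \<Longrightarrow> (s * s) ^ (r + 2) * (s' * s') \<le> card (C j)"
  shows "has_separated_clusters k s \<or> has_separated_clusters r s'"
proof (cases "has_separated_clusters k s")
  case no_k: False
  let ?m = "stage_size k r"
  have "1 + k * (k * ?m) \<le> K" using K by simp
  moreover have "(s * s) * ((s * s) * ((s * s) ^ r * (s' * s'))) \<le> card (C j)" if "j < K" for j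
    using size[OF that] by (simp add: mult_ac)
  ultimately obtain \<alpha> Z where \<alpha>: "1 \<le> \<alpha>" "\<alpha> + k * ?m \<le> K"
    and "disagreeing_subclusters {\<alpha>..<\<alpha> + k * ?m} ((s * s) * ((s * s) ^ r * (s' * s'))) Z"
    using opening_round[of 1 k "k * ?m" s] no_k by blast
  then obtain \<beta> Z' where \<beta>: "\<alpha> \<le> \<beta>" "\<beta> + ?m \<le> \<alpha> + k * ?m"
    and Z': "disagreeing_subclusters {\<beta>..<\<beta> + ?m} ((s * s) ^ r * (s' * s')) Z'"
      "\<forall>j\<in>{\<beta>..<\<beta> + ?m}. agrees_with_left \<alpha> (\<beta> + ?m) j (Z' j)"
    using query_round[OF \<alpha>(2)] no_k by blast
  obtain F where "card F = r" "nested_left_agreement (s' * s') \<alpha> F"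
    using query_rounds[OF \<beta>(1) _ _ assms(2) Z'] no_k \<alpha>(2) \<beta>(2) by auto
  then show ?thesis
    using separated_clusters_if_nested_left_agreement[of s' \<alpha> F] \<alpha>(1)
    unfolding has_separated_clusters_def by auto
qed simp

theorem cut_off_points_of_clusters:
  assumes "K = Suc (k * (k * stage_size k r))"
    and "\<And>j. j < K \<Longrightarrow> (s * s) ^ (r + 2) * (s' * s') \<le> card (C j)"
    and s: "(2 * n + 2 * l choose (2 * l)) < s" "n \<le> k * l"
    and s': "(2 * n + 2 * l' choose (2 * l')) < s'" "n \<le> r * l'"
  shows "cut_off_points X n"
proof -
  have "cut_off_points X n"
    if "has_separated_clusters i t" "(2 * n + 2 * m choose (2 * m)) < t" "n \<le> i * m" for i t m
    using that separated_clusters_cut_off_points unfolding has_separated_clusters_def by blast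
  moreover have "has_separated_clusters k s \<or> has_separated_clusters r s'"
    using assms(1,2) s(1) by (intro has_separated_clusters_if_large) auto
  ultimately show ?thesis using s s' by blast
qed

end

section \<open>Existence of clusters\<close>

lemma ramsey_sorted_quadruples:
  "\<exists>R::nat. \<forall>P. \<exists>H col::bool. H \<subseteq> {..<R} \<and> card H = L \<and>
    (\<forall>a\<in>H. \<forall>b\<in>H. \<forall>c\<in>H. \<forall>d\<in>H. a < b \<longrightarrow> b < c \<longrightarrow> c < d \<longrightarrow> P a b c d = col)"
proof -
  obtain R :: nat where R: "partn_lst {..<R} [L, L] 4" using ramsey_full by blast
  have "\<exists>H col::bool. H \<subseteq> {..<R} \<and> card H = L \<and>
    (\<forall>a\<in>H. \<forall>b\<in>H. \<forall>c\<in>H. \<forall>d\<in>H. a < b \<longrightarrow> b < c \<longrightarrow> c < d \<longrightarrow> P a b c d = col)" for P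
  proof -
    define color :: "nat set \<Rightarrow> nat" where
      "color S = (let q = sorted_list_of_set S in if P (q ! 0) (q ! 1) (q ! 2) (q ! 3) then 0 else 1)"
      for S
    have "color \<in> nsets {..<R} 4 \<rightarrow> {..<length [L, L]}" by (simp add: color_def Let_def)
    then obtain i H where iH: "i < length [L, L]" "H \<in> nsets {..<R} ([L, L] ! i)"
        "color ` nsets H 4 \<subseteq> {i}"
      using partn_lstE[OF R] by metis
    have "P a b c d = (i = 0)" if "{a, b, c, d} \<subseteq> H" "a < b" "b < c" "c < d" for a b c d
    proof -
      have "sorted_list_of_set (set [a, b, c, d]) = [a, b, c, d]"
        using that by (intro sorted_list_of_set.idem_if_sorted_distinct) auto
      moreover have "{a, b, c, d} \<in> nsets H 4" using that by (auto simp: nsets_def)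
      then have "color {a, b, c, d} = i" using iH(3) by blast
      ultimately show ?thesis by (auto simp: color_def split: if_splits)
    qed
    moreover have "H \<subseteq> {..<R}" "card H = L" using iH by (auto simp: nsets_def less_Suc_eq)
    ultimately show ?thesis by (intro exI[of _ H] exI[of _ "i = 0"]) auto
  qed
  then show ?thesis by blast
qed

lemma moment_ordered_cong:
  assumes "moment_ordered ori S f" "S' \<subseteq> S" "\<And>t. t \<in> S' \<Longrightarrow> f' t = f t"
  shows "moment_ordered ori S' f'"
  using assms unfolding moment_ordered_def by (auto simp: subset_iff)

context chirotope
begin

definition oriented_selections ::
    "nat \<Rightarrow> nat \<Rightarrow> ((nat \<Rightarrow> nat) \<times> ('p \<Rightarrow> 'p \<Rightarrow> 'p \<Rightarrow> 'p \<Rightarrow> real)) set" where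
  "oriented_selections R L = {e \<in> {..<L} \<rightarrow>\<^sub>E {..<R}. inj_on e {..<L}} \<times> orientations"

lemma finite_oriented_selections: "finite (oriented_selections R L)"
  unfolding oriented_selections_def orientations_def
  by (intro finite_cartesian_product finite_subset[of "{e \<in> _. _ e}" "{..<L} \<rightarrow>\<^sub>E {..<R}"])
    (auto intro: finite_PiE)

definition forces_moment_order :: "nat \<Rightarrow> nat \<Rightarrow> bool" where
  "forces_moment_order R L \<longleftrightarrow> (\<forall>f. inj_on f {..<R} \<longrightarrow> nondegenerate (f ` {..<R}) \<longrightarrow>
     (\<exists>(e, ori')\<in>oriented_selections R L. moment_ordered ori' {..<L} (f \<circ> e)))"

lemma ex_forces_moment_order: "\<exists>R. forces_moment_order R L"
proof -
  obtain R :: nat where R: "\<forall>P. \<exists>H col::bool. H \<subseteq> {..<R} \<and> card H = L \<and>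
    (\<forall>a\<in>H. \<forall>b\<in>H. \<forall>c\<in>H. \<forall>d\<in>H. a < b \<longrightarrow> b < c \<longrightarrow> c < d \<longrightarrow> P a b c d = col)"
    using ramsey_sorted_quadruples[of L] by (elim exE)
  have "\<exists>(e, ori')\<in>oriented_selections R L. moment_ordered ori' {..<L} (f \<circ> e)"
    if f: "inj_on f {..<R}" "nondegenerate (f ` {..<R})" for f
  proof -
    obtain H col where H: "H \<subseteq> {..<R}" "card H = L" and col: "\<forall>a\<in>H. \<forall>b\<in>H. \<forall>c\<in>H. \<forall>d\<in>H.
        a < b \<longrightarrow> b < c \<longrightarrow> c < d \<longrightarrow> (0 < ori (f a) (f b) (f c) (f d)) = col"
      using R[rule_format, of "\<lambda>a b c d. 0 < ori (f a) (f b) (f c) (f d)"] by blast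
    obtain h where h: "bij_betw h {..<L} H" "strict_mono_on {..<L} h"
      using ex_bij_betw_strict_mono_card[of H] H finite_subset
      by (metis atLeast0LessThan finite_lessThan)
    define e where "e = restrict h {..<L}"
    have e: "e \<in> {..<L} \<rightarrow>\<^sub>E {..<R}" "inj_on e {..<L}"
      using h(1) H(1) by (auto simp: e_def bij_betw_def)
    have "(if col then 0 < ori (f (e a)) (f (e b)) (f (e c)) (f (e d))
        else 0 < - ori (f (e a)) (f (e b)) (f (e c)) (f (e d)))"
      if "{a, b, c, d} \<subseteq> {..<L}" "a < b" "b < c" "c < d" for a b c d
    proof -
      have mono: "e a < e b" "e b < e c" "e c < e d"
        using strict_mono_onD[OF h(2)] that by (auto simp: e_def)
      have eH: "e t \<in> H" if "t < L" for t using h(1) that by (auto simp: e_def bij_betw_def)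
      then have "(0 < ori (f (e a)) (f (e b)) (f (e c)) (f (e d))) = col"
        using col mono that by simp
      moreover have sub: "{e a, e b, e c, e d} \<subseteq> {..<R}" using eH H(1) that by blast
      then have "distinct [f (e a), f (e b), f (e c), f (e d)]"
        using mono by (auto simp: inj_on_eq_iff[OF f(1)])
      then have "ori (f (e a)) (f (e b)) (f (e c)) (f (e d)) \<noteq> 0"
        using f(2) sub unfolding nondegenerate_def by blast
      ultimately show ?thesis by auto
    qed
    then have "\<exists>ori'\<in>orientations. moment_ordered ori' {..<L} (f \<circ> e)"
      by (cases col) (simp_all add: moment_ordered_def orientations_def)
    then show ?thesis using e by (auto simp: oriented_selections_def)
  qed
  then show ?thesis unfolding forces_moment_order_def by blast
qed

lemma moment_clusters_of_fibre:
  assumes X: "finite X" "nondegenerate X" "\<And>i. i \<in> I \<Longrightarrow> A i \<subseteq> X"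
    and e: "inj_on e {..<4 * K + 1}" "e \<in> {..<4 * K + 1} \<rightarrow> I"
    and g: "g \<in> Pi (I - e ` (\<lambda>j. 4 * j + 2) ` {..<K}) A"
    and F: "\<And>f. f \<in> F \<Longrightarrow> f \<in> Pi I A \<and> moment_ordered ori {..<4 * K + 1} (f \<circ> e)"
    and C: "\<And>j. j < K \<Longrightarrow>
      C j = fibre_values F (I - e ` (\<lambda>j. 4 * j + 2) ` {..<K}) g (e (4 * j + 2)) \<and> C j \<noteq> {}"
  shows "moment_clusters ori X K (g \<circ> e) C"
proof unfold_locales
  let ?V = "e ` (\<lambda>j. 4 * j + 2) ` {..<K}"
  have e_single: "e t \<in> I - ?V" if "t \<in> single_positions K" for t
  proof -
    have "t < 4 * K + 1" "t \<noteq> 4 * j + 2" for j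
      using that single_positions_neq by (auto simp: single_positions_def)
    then show ?thesis
      using e(2) inj_onD[OF e(1), of t] by (fastforce simp: Pi_iff)
  qed
  show "(g \<circ> e) t \<in> X" if "t \<in> single_positions K" for t
    using e_single[OF that] g X(3) by auto
  fix j assume j: "j < K"
  have "e (4 * j + 2) \<in> I" using e(2) j by auto
  then have "fibre_values F (I - ?V) g (e (4 * j + 2)) \<subseteq> A (e (4 * j + 2))"
    using F by (intro fibre_values_subset[of _ I]) auto
  then show "C j \<subseteq> X" using X(3) C[OF j] \<open>e (4 * j + 2) \<in> I\<close> by blast
  show "C j \<noteq> {}" using C[OF j] by blast
  fix y assume "y \<in> C j"
  then obtain f where f: "f \<in> F" "\<forall>i\<in>I - ?V. f i = g i" "y = f (e (4 * j + 2))"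
    using C[OF j] by (auto simp: fibre_values_def)
  show "moment_ordered ori (insert (4 * j + 2) (single_positions K)) ((g \<circ> e)(4 * j + 2 := y))"
  proof (rule moment_ordered_cong)
    show "moment_ordered ori {..<4 * K + 1} (f \<circ> e)" using F[OF f(1)] by blast
    show "insert (4 * j + 2) (single_positions K) \<subseteq> {..<4 * K + 1}"
      using j by (auto simp: single_positions_def)
    show "((g \<circ> e)(4 * j + 2 := y)) t = (f \<circ> e) t"
      if "t \<in> insert (4 * j + 2) (single_positions K)" for t
      using that f(2,3) e_single[of t] by auto
  qed
qed (fact X(1,2))+

lemma ex_large_fibre_moment_ordered:
  assumes forces: "forces_moment_order R L" and "nondegenerate X" and W: "W \<subseteq> {..<L}"
    and disjoint: "disjoint_family_on A {..<R}"
    and A: "\<forall>i<R. A i \<subseteq> X \<and> finite (A i) \<and> A i \<noteq> {}"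
  shows "\<exists>e ori' g. (e, ori') \<in> oriented_selections R L \<and> g \<in> PiE ({..<R} - e ` W) A \<and>
    (\<forall>v\<in>e ` W. card (A v) \<le> card (oriented_selections R L) *
      card (fibre_values {f \<in> PiE {..<R} A. moment_ordered ori' {..<L} (f \<circ> e)} ({..<R} - e ` W) g v))"
proof -
  let ?T = "oriented_selections R L"
  define ordered where "ordered t f \<longleftrightarrow> moment_ordered (snd t) {..<L} (f \<circ> fst t)"
    for t :: "(nat \<Rightarrow> nat) \<times> ('p \<Rightarrow> 'p \<Rightarrow> 'p \<Rightarrow> 'p \<Rightarrow> real)" and f :: "nat \<Rightarrow> 'p"
  have "\<exists>t\<in>?T. ordered t f" if f: "f \<in> PiE {..<R} A" for f
  proof -
    have "f ` {..<R} \<subseteq> X" using PiE_mem[OF f] A by blast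
    then obtain e ori' where "(e, ori') \<in> ?T" "moment_ordered ori' {..<L} (f \<circ> e)"
      using forces inj_on_PiE_disjoint[OF f disjoint] nondegenerate_subset[OF assms(2)]
      unfolding forces_moment_order_def by blast
    then show ?thesis by (intro bexI[of _ "(e, ori')"]) (simp_all add: ordered_def)
  qed
  then have "\<exists>t\<in>?T. \<exists>g\<in>PiE ({..<R} - fst t ` W) A. \<forall>v\<in>fst t ` W. card (A v) \<le> card ?T *
      card (fibre_values {f \<in> PiE {..<R} A. ordered t f} ({..<R} - fst t ` W) g v)"
    using finite_oriented_selections A W
    by (intro coordinatewise_pigeonhole) (auto simp: oriented_selections_def PiE_def Pi_iff)
  then obtain t g where "t \<in> ?T" "g \<in> PiE ({..<R} - fst t ` W) A"
    "\<forall>v\<in>fst t ` W. card (A v) \<le> card ?T *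
      card (fibre_values {f \<in> PiE {..<R} A. ordered t f} ({..<R} - fst t ` W) g v)"
    by (elim bexE)
  then show ?thesis
    by (intro exI[of _ "fst t"] exI[of _ "snd t"] exI[of _ g]) (simp add: ordered_def)
qed

lemma moment_clusters_if_forces_moment_order:
  assumes R: "forces_moment_order R (4 * K + 1)" and X: "finite X" "nondegenerate X"
    and "0 < s" "R * (Suc (card (oriented_selections R (4 * K + 1))) * s) \<le> card X"
  shows "\<exists>ori'\<in>orientations. \<exists>p C. moment_clusters ori' X K p C \<and> (\<forall>j<K. s \<le> card (C j))"
proof -
  let ?I = "{..<R}" and ?W = "(\<lambda>j. 4 * j + 2) ` {..<K}"
    and ?N = "card (oriented_selections R (4 * K + 1))"
  obtain A where disjoint: "disjoint_family_on A ?I" and A: "\<forall>i<R. A i \<subseteq> X \<and> card (A i) = Suc ?N * s"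
    using ex_disjoint_subsets[OF X(1) assms(5)] by auto
  have W: "?W \<subseteq> {..<4 * K + 1}" by auto
  have "\<forall>i<R. A i \<subseteq> X \<and> finite (A i) \<and> A i \<noteq> {}"
    using A \<open>0 < s\<close> X(1) finite_subset by fastforce
  from ex_large_fibre_moment_ordered[OF R X(2) W disjoint this]
  obtain e ori' g where "(e, ori') \<in> oriented_selections R (4 * K + 1)"
    and g: "g \<in> PiE (?I - e ` ?W) A"
    and large: "\<forall>v\<in>e ` ?W. card (A v) \<le> ?N * card (fibre_values
      {f \<in> PiE ?I A. moment_ordered ori' {..<4 * K + 1} (f \<circ> e)} (?I - e ` ?W) g v)"
    by (elim exE conjE)
  then have e: "e \<in> {..<4 * K + 1} \<rightarrow> ?I" "inj_on e {..<4 * K + 1}" and ori': "ori' \<in> orientations"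
    by (auto simp: oriented_selections_def)
  define F where "F = {f \<in> PiE ?I A. moment_ordered ori' {..<4 * K + 1} (f \<circ> e)}"
  define C where "C j = fibre_values F (?I - e ` ?W) g (e (4 * j + 2))" for j
  have C: "s \<le> card (C j)" if "j < K" for j
  proof -
    have "e (4 * j + 2) \<in> e ` ?W" "e (4 * j + 2) < R" using that e(1) by auto
    then have "Suc ?N * s \<le> ?N * card (C j)"
      using large[rule_format, of "e (4 * j + 2)"] A unfolding C_def F_def by simp
    also have "\<dots> \<le> Suc ?N * card (C j)" by simp
    finally show ?thesis by (simp only: Suc_mult_le_cancel1)
  qed
  interpret oriented: chirotope ori' using ori' by (rule chirotope_orientations)
  have "moment_clusters ori' X K (g \<circ> e) C"
  proof (rule oriented.moment_clusters_of_fibre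
      [OF X(1) nondegenerate_orientations[OF ori' X(2)] _ e(2,1)])
    show "C j = fibre_values F (?I - e ` ?W) g (e (4 * j + 2)) \<and> C j \<noteq> {}" if "j < K" for j
      using C[OF that] \<open>0 < s\<close> by (auto simp: C_def)
  qed (use A g in \<open>auto simp: F_def\<close>)
  then show ?thesis using ori' C by blast
qed

lemma ex_moment_clusters:
  "\<exists>R. \<forall>X s. finite X \<longrightarrow> nondegenerate X \<longrightarrow> 0 < s \<longrightarrow> R * s \<le> card X \<longrightarrow>
    (\<exists>ori'\<in>orientations. \<exists>p C. moment_clusters ori' X K p C \<and> (\<forall>j<K. s \<le> card (C j)))"
proof -
  obtain R where "forces_moment_order R (4 * K + 1)" using ex_forces_moment_order by blast
  from moment_clusters_if_forces_moment_order[OF this] show ?thesis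
    unfolding mult.assoc[symmetric] by blast
qed

end

section \<open>Subexponential bounds\<close>

lemma binomial_le_power_divide:
  fixes x :: real
  assumes "0 < x" "k \<le> n"
  shows "real (n choose k) \<le> (1 + x) ^ n / x ^ k"
proof -
  have "real (n choose k) * x ^ k \<le> (\<Sum>i\<le>n. real (n choose i) * x ^ i)"
    using assms by (intro member_le_sum[of k "{..n}" "\<lambda>i. real (n choose i) * x ^ i"]) auto
  also have "\<dots> = (1 + x) ^ n" using binomial_ring[of x 1 n] by (simp add: add.commute)
  finally show ?thesis using assms(1) by (simp add: field_simps)
qed

definition bulge_bound :: "nat \<Rightarrow> nat \<Rightarrow> nat" where
  "bulge_bound r n = (let l = n div r + 1 in 2 * n + 2 * l choose (2 * l))"

lemma bulge_bound_le_exp: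
  assumes "0 < r" "0 < x" "x < (1::real)"
  shows "real (bulge_bound r n) \<le> exp ((4 * x - 2 * ln x / real r) * real n + (2 * x - 2 * ln x))"
proof -
  define l where "l = n div r + 1"
  have "ln x < 0" using assms(2,3) by simp
  have "n div r \<le> n" by simp
  then have "real (2 * n + 2 * l) \<le> 4 * real n + 2" by (simp add: l_def)
  moreover have "real (n div r) \<le> real n / real r" by (rule of_nat_div_le_of_nat)
  then have "real (2 * l) \<le> 2 * real n / real r + 2" by (simp add: l_def)
  ultimately have exponent: "real (2 * n + 2 * l) * x + real (2 * l) * (- ln x) \<le>
      (4 * real n + 2) * x + (2 * real n / real r + 2) * (- ln x)"
    using assms(2) \<open>ln x < 0\<close> by (intro add_mono mult_right_mono) auto
  have "real (bulge_bound r n) \<le> (1 + x) ^ (2 * n + 2 * l) / x ^ (2 * l)"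
    unfolding bulge_bound_def Let_def l_def[symmetric] using assms(2)
    by (intro binomial_le_power_divide) auto
  also have "\<dots> \<le> exp x ^ (2 * n + 2 * l) / x ^ (2 * l)"
    using assms(2) exp_ge_add_one_self[of x] by (intro divide_right_mono power_mono) auto
  also have "\<dots> = exp (real (2 * n + 2 * l) * x + real (2 * l) * (- ln x))"
    unfolding exp_add exp_of_nat_mult using assms(2)
    by (simp add: exp_minus power_inverse divide_inverse)
  also have "\<dots> \<le> exp ((4 * x - 2 * ln x / real r) * real n + (2 * x - 2 * ln x))"
    using exponent by (simp add: algebra_simps)
  finally show ?thesis .
qed

lemma bulge_bound_subexponential:
  assumes "0 < \<mu>"
  shows "\<exists>r>0. \<forall>\<^sub>F n in sequentially. real (Suc (bulge_bound r n)) \<le> 2 powr (\<mu> * real n)"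
proof -
  define \<nu> where "\<nu> = \<mu> * ln 2"
  define x where "x = min (1 / 2) (\<nu> / 16)"
  have "0 < \<nu>" using assms by (simp add: \<nu>_def)
  then have x: "0 < x" "x < 1" "4 * x \<le> \<nu> / 4" by (auto simp: x_def)
  obtain r :: nat where r: "8 * (- ln x) / \<nu> < real r" using reals_Archimedean2 by blast
  have "0 < 8 * (- ln x) / \<nu>" using x \<open>0 < \<nu>\<close> by (intro divide_pos_pos) auto
  then have "0 < r" using r by (metis less_trans of_nat_0_less_iff)
  moreover have "8 * (- ln x) < real r * \<nu>" using r \<open>0 < \<nu>\<close> by (simp add: field_simps)
  ultimately have "- 2 * ln x / real r \<le> \<nu> / 4" by (simp add: field_simps)
  then have rate: "(4 * x - 2 * ln x / real r) * real n \<le> \<nu> / 2 * real n" for n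
    using x(3) by (intro mult_right_mono) auto
  have "\<forall>\<^sub>F n in sequentially. exp (\<nu> / 2 * real n + (2 * x - 2 * ln x)) + 1 \<le> exp (\<nu> * real n)"
    using \<open>0 < \<nu>\<close> by real_asymp
  then have "\<forall>\<^sub>F n in sequentially. real (Suc (bulge_bound r n)) \<le> 2 powr (\<mu> * real n)"
  proof eventually_elim
    case (elim n)
    have "exp ((4 * x - 2 * ln x / real r) * real n + (2 * x - 2 * ln x)) \<le>
        exp (\<nu> / 2 * real n + (2 * x - 2 * ln x))"
      using rate[of n] by simp
    moreover have "exp (\<nu> * real n) = 2 powr (\<mu> * real n)" by (simp add: powr_def \<nu>_def mult_ac)
    ultimately show ?case using bulge_bound_le_exp[OF \<open>0 < r\<close> x(1,2), of n] elim by linarith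
  qed
  then show ?thesis using \<open>0 < r\<close> by blast
qed

definition cluster_size :: "nat \<Rightarrow> nat \<Rightarrow> nat \<Rightarrow> nat" where
  "cluster_size k r n = (Suc (bulge_bound k n) * Suc (bulge_bound k n)) ^ (r + 2) *
     (Suc (bulge_bound r n) * Suc (bulge_bound r n))"

lemma cluster_size_subexponential:
  assumes "0 < \<delta>"
  shows "\<exists>r>0. \<exists>k>0. \<forall>R. \<forall>\<^sub>F n in sequentially. real (R * cluster_size k r n) \<le> 2 powr (\<delta> * real n)"
proof -
  obtain r where r: "0 < r"
      "\<forall>\<^sub>F n in sequentially. real (Suc (bulge_bound r n)) \<le> 2 powr (\<delta> / 8 * real n)"
    using bulge_bound_subexponential[of "\<delta> / 8"] assms by auto
  define \<mu> where "\<mu> = \<delta> / (8 * real (r + 2))"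
  have "0 < \<mu>" using assms by (simp add: \<mu>_def)
  then obtain k where k: "0 < k"
      "\<forall>\<^sub>F n in sequentially. real (Suc (bulge_bound k n)) \<le> 2 powr (\<mu> * real n)"
    using bulge_bound_subexponential by blast
  have rate: "real (r + 2) * (\<mu> * real n + \<mu> * real n) = \<delta> / 4 * real n" for n
  proof -
    have "0 < 16 + 8 * real r" by (simp add: add_pos_nonneg)
    then have split: "real (r + 2) * \<mu> = \<delta> / 8" by (simp add: \<mu>_def field_simps)
    show ?thesis unfolding distrib_left mult.assoc[symmetric] split by simp
  qed
  have "\<forall>\<^sub>F n in sequentially. real (R * cluster_size k r n) \<le> 2 powr (\<delta> * real n)" for R
  proof -
    have "\<forall>\<^sub>F n in sequentially. real R \<le> 2 powr (\<delta> / 2 * real n)" using assms by real_asymp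
    with r(2) k(2) show ?thesis
    proof eventually_elim
      case (elim n)
      let ?s = "real (Suc (bulge_bound k n))" and ?s' = "real (Suc (bulge_bound r n))"
      have "real (R * cluster_size k r n) = real R * ((?s * ?s) ^ (r + 2) * (?s' * ?s'))"
        by (simp only: cluster_size_def of_nat_mult of_nat_power)
      also have "\<dots> \<le> 2 powr (\<delta> / 2 * real n) *
          ((2 powr (\<mu> * real n) * 2 powr (\<mu> * real n)) ^ (r + 2) *
           (2 powr (\<delta> / 8 * real n) * 2 powr (\<delta> / 8 * real n)))"
        using elim by (intro mult_mono power_mono) auto
      also have "\<dots> = 2 powr (\<delta> / 2 * real n + (real (r + 2) * (\<mu> * real n + \<mu> * real n) +
          (\<delta> / 8 * real n + \<delta> / 8 * real n)))"
        by (simp add: powr_power algebra_simps flip: powr_add)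
      also have "\<dots> = 2 powr (\<delta> * real n)" unfolding rate by simp
      finally show ?case .
    qed
  qed
  then show ?thesis using r(1) k(1) by blast
qed

theorem (in chirotope) cut_off_points_subexponential:
  assumes "0 < \<delta>"
  shows "\<forall>\<^sub>F n in sequentially. \<forall>X. finite X \<longrightarrow> nondegenerate X \<longrightarrow>
    2 powr (\<delta> * real n) \<le> real (card X) \<longrightarrow> cut_off_points X n"
proof -
  obtain r k where rk: "0 < r" "0 < k" and size: "\<And>R. \<forall>\<^sub>F n in sequentially.
      real (R * cluster_size k r n) \<le> 2 powr (\<delta> * real n)"
    using cluster_size_subexponential[OF assms] by blast
  define K where "K = Suc (k * (k * stage_size k r))"
  obtain R where R: "\<forall>X s. finite X \<longrightarrow> nondegenerate X \<longrightarrow> 0 < s \<longrightarrow> R * s \<le> card X \<longrightarrow>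
    (\<exists>ori'\<in>orientations. \<exists>p C. moment_clusters ori' X K p C \<and> (\<forall>j<K. s \<le> card (C j)))"
    using ex_moment_clusters[of K] by (elim exE)
  show ?thesis
    using size[of R]
  proof eventually_elim
    case (elim n)
    show ?case
    proof (intro allI impI)
      fix X assume X: "finite X" "nondegenerate X" "2 powr (\<delta> * real n) \<le> real (card X)"
      have "R * cluster_size k r n \<le> card X" using elim X(3) by linarith
      moreover have "0 < cluster_size k r n" by (simp add: cluster_size_def)
      ultimately obtain ori' p C where ori': "ori' \<in> orientations"
        and "moment_clusters ori' X K p C" and C: "\<forall>j<K. cluster_size k r n \<le> card (C j)"
        using R X(1,2) by blast
      interpret clusters: moment_clusters ori' X K p C by fact
      have "clusters.cut_off_points X n"
      proof (rule clusters.cut_off_points_of_clusters[OF K_def])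
        show "(Suc (bulge_bound k n) * Suc (bulge_bound k n)) ^ (r + 2) *
          (Suc (bulge_bound r n) * Suc (bulge_bound r n)) \<le> card (C j)" if "j < K" for j
          using C that unfolding cluster_size_def by blast
        show "(2 * n + 2 * (n div k + 1) choose (2 * (n div k + 1))) < Suc (bulge_bound k n)"
          "(2 * n + 2 * (n div r + 1) choose (2 * (n div r + 1))) < Suc (bulge_bound r n)"
          by (simp_all add: bulge_bound_def)
        show "n \<le> k * (n div k + 1)" "n \<le> r * (n div r + 1)"
          using rk by (simp_all add: less_imp_le dividend_less_times_div algebra_simps)
      qed
      then show "cut_off_points X n" using ori' by (rule cut_off_points_orientations[rotated])
    qed
  qed
qed

section \<open>Positive fractions\<close>

context chirotope
begin

lemma separating_planes_singletons_distinct: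
  assumes "separating_planes I a b c (\<lambda>i. {v i})"
  shows "inj_on v I" and "i \<in> I \<Longrightarrow> j \<in> I \<Longrightarrow> v i \<notin> {a j, b j, c j}"
proof -
  have nonzero: "ori (a j) (b j) (c j) (v i) \<noteq> 0" if "i \<in> I" "j \<in> I" for i j
    using assms that unfolding separating_planes_def by (cases "i = j") force+
  show "inj_on v I"
    using assms unfolding separating_planes_def
    by (intro inj_onI) (metis Diff_iff insertI1 not_less_iff_gr_or_eq singletonD)
  show "v i \<notin> {a j, b j, c j}" if "i \<in> I" "j \<in> I"
    using nonzero[OF that] by auto
qed

lemma cut_off_points_image:
  assumes "cut_off_points (f ` I) m"
  shows "\<exists>v a b c. {v, a, b, c} \<subseteq> {..<m} \<rightarrow>\<^sub>E I \<and>
    separating_planes {..<m} (f \<circ> a) (f \<circ> b) (f \<circ> c) (\<lambda>i. {f (v i)})"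
proof -
  obtain v a b c where vabc: "{v, a, b, c} \<subseteq> {..<m} \<rightarrow> f ` I"
      "separating_planes {..<m} a b c (\<lambda>i. {v i})"
    using assms unfolding cut_off_points_def by blast
  define label where "label h = restrict (inv_into I f \<circ> h) {..<m}" for h :: "nat \<Rightarrow> 'p"
  have label: "label h \<in> {..<m} \<rightarrow>\<^sub>E I" "\<And>i. i < m \<Longrightarrow> f (label h i) = h i" if "h \<in> {..<m} \<rightarrow> f ` I" for h
    using that by (auto simp: label_def Pi_iff inv_into_into f_inv_into_f)
  have "separating_planes {..<m} (f \<circ> label a) (f \<circ> label b) (f \<circ> label c) (\<lambda>i. {f (label v i)})"
    using vabc label(2) by (simp add: separating_planes_def)
  then show ?thesis
    using label(1) vabc(1)
    by (intro exI[of _ "label v"] exI[of _ "label a"] exI[of _ "label b"] exI[of _ "label c"]) auto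
qed

lemma separating_planes_fibre_values:
  assumes "F \<noteq> {}" and F: "\<And>f. f \<in> F \<Longrightarrow> separating_planes J (f \<circ> a) (f \<circ> b) (f \<circ> c) (\<lambda>i. {f (v i)})"
    and labels: "{v, a, b, c} \<subseteq> J \<rightarrow> I"
  shows "inj_on v J"
    and "separating_planes J (g \<circ> a) (g \<circ> b) (g \<circ> c) (\<lambda>i. fibre_values F (I - v ` J) g (v i))"
proof -
  obtain h where h: "h \<in> F" using \<open>F \<noteq> {}\<close> by blast
  note distinct = separating_planes_singletons_distinct[OF F[OF h]]
  show "inj_on v J" using distinct(1) by (auto simp: inj_on_def)
  have fixed: "{a i, b i, c i} \<subseteq> I - v ` J" if "i \<in> J" for i
  proof -
    have "h (v j) \<notin> {h (a i), h (b i), h (c i)}" if "j \<in> J" for j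
      using distinct(2)[of j i] \<open>i \<in> J\<close> that by simp
    then show ?thesis using labels that by (auto simp: Pi_iff) metis+
  qed
  have "(j = i \<longrightarrow> 0 < ori (g (a i)) (g (b i)) (g (c i)) x) \<and>
      (j \<noteq> i \<longrightarrow> ori (g (a i)) (g (b i)) (g (c i)) x < 0)"
    if ij: "i \<in> J" "j \<in> J" and x: "x \<in> fibre_values F (I - v ` J) g (v j)" for i j x
  proof -
    obtain f where f: "f \<in> F" "\<forall>k\<in>I - v ` J. f k = g k" "x = f (v j)"
      using x by (auto simp: fibre_values_def)
    then have "g (a i) = f (a i)" "g (b i) = f (b i)" "g (c i) = f (c i)"
      using fixed[OF ij(1)] by auto
    then show ?thesis using F[OF f(1)] ij f(3) by (simp add: separating_planes_def)
  qed
  then show "separating_planes J (g \<circ> a) (g \<circ> b) (g \<circ> c) (\<lambda>i. fibre_values F (I - v ` J) g (v i))"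
    unfolding separating_planes_def by auto
qed

lemma ex_large_fibre_separating:
  fixes I :: "'i set"
  assumes "finite I" and A: "\<forall>i\<in>I. finite (A i) \<and> A i \<noteq> {}"
    and cut: "\<forall>f\<in>PiE I A. cut_off_points (f ` I) m"
  shows "\<exists>v a b c F g. {v, a, b, c} \<subseteq> {..<m} \<rightarrow> I \<and> F \<subseteq> PiE I A \<and>
    (\<forall>f\<in>F. separating_planes {..<m} (f \<circ> a) (f \<circ> b) (f \<circ> c) (\<lambda>i. {f (v i)})) \<and>
    (\<Prod>u\<in>v ` {..<m}. card (A u)) \<le>
      card I ^ (4 * m) * (\<Prod>u\<in>v ` {..<m}. card (fibre_values F (I - v ` {..<m}) g u))"
proof -
  define L where "L = {..<m} \<rightarrow>\<^sub>E I"
  define T where "T = L \<times> L \<times> L \<times> L"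
  have "finite L" "card L = card I ^ m" using assms(1) by (simp_all add: L_def finite_PiE card_PiE)
  then have "finite T" and card_T: "card T = card I ^ (4 * m)"
    by (simp_all add: T_def card_cartesian_product numeral_eq_Suc power_add)
  define P where "P t f \<longleftrightarrow>
      (case t of (v, a, b, c) \<Rightarrow> separating_planes {..<m} (f \<circ> a) (f \<circ> b) (f \<circ> c) (\<lambda>i. {f (v i)}))"
    for t :: "(nat \<Rightarrow> 'i) \<times> (nat \<Rightarrow> 'i) \<times> (nat \<Rightarrow> 'i) \<times> (nat \<Rightarrow> 'i)" and f :: "'i \<Rightarrow> 'p"
  have "\<exists>t\<in>T. P t f" if f: "f \<in> PiE I A" for f
  proof -
    from cut_off_points_image[OF cut[rule_format, OF f]] obtain v a b c where "{v, a, b, c} \<subseteq> L"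
        "separating_planes {..<m} (f \<circ> a) (f \<circ> b) (f \<circ> c) (\<lambda>i. {f (v i)})"
      unfolding L_def by (elim exE conjE)
    then show ?thesis by (intro bexI[of _ "(v, a, b, c)"]) (auto simp: T_def P_def)
  qed
  then have "\<exists>t\<in>T. \<exists>g\<in>PiE (I - fst t ` {..<m}) A. (\<Prod>u\<in>fst t ` {..<m}. card (A u)) \<le> card T *
      (\<Prod>u\<in>fst t ` {..<m}. card (fibre_values {f \<in> PiE I A. P t f} (I - fst t ` {..<m}) g u))"
    using assms(1) \<open>finite T\<close> A
    by (intro product_pigeonhole) (auto simp: T_def L_def PiE_def Pi_iff)
  then obtain v a b c g where labels: "(v, a, b, c) \<in> T"
    and "(\<Prod>u\<in>v ` {..<m}. card (A u)) \<le> card T * (\<Prod>u\<in>v ` {..<m}.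
      card (fibre_values {f \<in> PiE I A. P (v, a, b, c) f} (I - v ` {..<m}) g u))"
    by auto
  moreover have "{v, a, b, c} \<subseteq> {..<m} \<rightarrow> I" using labels by (auto simp: T_def L_def)
  ultimately show ?thesis
    unfolding card_T
    by (intro exI[of _ v] exI[of _ a] exI[of _ b] exI[of _ c]
        exI[of _ "{f \<in> PiE I A. P (v, a, b, c) f}"] exI[of _ g])
      (auto simp: P_def)
qed

lemma ex_large_separated_parts:
  assumes "finite X" "0 < S" "S \<le> card X" "0 < m"
    and cut: "\<forall>Y\<subseteq>X. card Y = S \<longrightarrow> cut_off_points Y m"
  shows "\<exists>B a b c. separating_planes {..<m} a b c B \<and>
    (\<forall>i<m. B i \<subseteq> X \<and> card (B i) \<le> card X div S) \<and>
    (card X div S) ^ m \<le> S ^ (4 * m) * (\<Prod>i<m. card (B i))"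
proof -
  let ?I = "{..<S}" and ?s = "card X div S"
  have "0 < ?s" using assms(2,3) by (simp add: div_greater_zero_iff)
  have "S * ?s \<le> card X" by simp
  then obtain A where disjoint: "disjoint_family_on A ?I"
    and A: "\<And>i. i < S \<Longrightarrow> A i \<subseteq> X \<and> card (A i) = ?s"
    using ex_disjoint_subsets[OF assms(1)] by blast
  have finite_A: "\<forall>i\<in>?I. finite (A i) \<and> A i \<noteq> {}"
    using A \<open>0 < ?s\<close> assms(1) finite_subset by fastforce
  have "\<forall>f\<in>PiE ?I A. cut_off_points (f ` ?I) m"
  proof
    fix f assume f: "f \<in> PiE ?I A"
    have "f ` ?I \<subseteq> X" using f A by (fastforce simp: PiE_def Pi_iff)
    then show "cut_off_points (f ` ?I) m"
      using cut inj_on_PiE_disjoint[OF f disjoint] by (simp add: card_image)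
  qed
  from ex_large_fibre_separating[of ?I A m, OF finite_lessThan finite_A this] obtain v a b c F g where
    labels: "{v, a, b, c} \<subseteq> {..<m} \<rightarrow> ?I" and F: "F \<subseteq> PiE ?I A"
    and separating: "\<forall>f\<in>F. separating_planes {..<m} (f \<circ> a) (f \<circ> b) (f \<circ> c) (\<lambda>i. {f (v i)})"
    and large: "(\<Prod>u\<in>v ` {..<m}. card (A u)) \<le>
      card ?I ^ (4 * m) * (\<Prod>u\<in>v ` {..<m}. card (fibre_values F (?I - v ` {..<m}) g u))"
    by (elim exE conjE)
  define B where "B i = fibre_values F (?I - v ` {..<m}) g (v i)" for i
  have "0 < (\<Prod>u\<in>v ` {..<m}. card (A u))"
    using finite_A labels by (intro prod_pos) (auto simp: card_gt_0_iff)
  then have "card ?I ^ (4 * m) * (\<Prod>u\<in>v ` {..<m}. card (fibre_values F (?I - v ` {..<m}) g u)) \<noteq> 0"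
    using large by linarith
  then have "\<forall>i<m. card (B i) \<noteq> 0" by (simp add: B_def)
  then have "B 0 \<noteq> {}" using \<open>0 < m\<close> by force
  then have "F \<noteq> {}" by (auto simp: B_def fibre_values_def)
  note planes = separating_planes_fibre_values[OF this separating[rule_format] labels]
  have "B i \<subseteq> X \<and> card (B i) \<le> ?s" if "i < m" for i
  proof -
    have v: "v i < S" using labels that by auto
    then have "B i \<subseteq> A (v i)" unfolding B_def using F by (intro fibre_values_subset[of _ ?I]) auto
    moreover have "finite (A (v i))" using finite_A v by simp
    ultimately show ?thesis using A[OF v] card_mono[of "A (v i)" "B i"] by auto
  qed
  moreover have "(\<Prod>u\<in>v ` {..<m}. card (A u)) = ?s ^ m"
    using A labels by (simp add: prod.reindex[OF planes(1)] Pi_iff)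
  then have "?s ^ m \<le> S ^ (4 * m) * (\<Prod>i<m. card (B i))"
    using large by (simp add: prod.reindex[OF planes(1)] B_def)
  ultimately show ?thesis using planes(2)[of g] unfolding B_def by blast
qed

theorem positive_fraction_cut_off:
  assumes "finite X" "0 < S" "S \<le> card X"
    and cut: "\<forall>Y\<subseteq>X. card Y = S \<longrightarrow> cut_off_points Y (2 * n)"
  shows "\<exists>B a b c. separating_planes {1..n} a b c B \<and>
    (\<forall>i\<in>{1..n}. B i \<subseteq> X \<and> card X \<le> 2 * S ^ 9 * card (B i))"
proof (cases "n = 0")
  case True
  then show ?thesis by (simp add: separating_planes_def)
next
  case False
  let ?s = "card X div S"
  have "0 < ?s" using assms(2,3) by (simp add: div_greater_zero_iff)
  have "0 < 2 * n" using False by simp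
  from ex_large_separated_parts[OF assms(1-3) this cut]
  obtain B a b c where planes: "separating_planes {..<2 * n} a b c B"
    and B: "\<forall>i<2 * n. B i \<subseteq> X \<and> card (B i) \<le> ?s"
    and prod: "?s ^ (2 * n) \<le> S ^ (4 * (2 * n)) * (\<Prod>i<2 * n. card (B i))"
    by (elim exE conjE)
  define G where "G = {i \<in> {..<2 * n}. ?s \<le> (S ^ 4)\<^sup>2 * card (B i)}"
  have "2 * n \<le> 2 * card G"
    using half_of_factors_large[of "{..<2 * n}" "\<lambda>i. card (B i)" ?s "S ^ 4"] B prod \<open>0 < ?s\<close> assms(2)
    unfolding G_def by (simp flip: power_mult)
  then obtain G' where G': "G' \<subseteq> G" "card G' = n"
    by (meson mult_le_cancel1 obtain_subset_with_card_n pos2)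
  moreover have "finite G" by (simp add: G_def)
  ultimately obtain h where h: "bij_betw h {1..n} G'"
    using finite_same_card_bij[of "{1..n}" G'] finite_subset by auto
  then have hG: "h i \<in> G" if "i \<in> {1..n}" for i using G'(1) that by (auto simp: bij_betw_def)
  have "separating_planes {1..n} (a \<circ> h) (b \<circ> h) (c \<circ> h) (B \<circ> h)"
    using h G'(1) by (intro separating_planes_reindex[OF planes]) (auto simp: bij_betw_def G_def)
  moreover have "B (h i) \<subseteq> X \<and> card X \<le> 2 * S ^ 9 * card (B (h i))" if "i \<in> {1..n}" for i
  proof
    show "B (h i) \<subseteq> X" using B hG[OF that] by (simp add: G_def)
    have "card X < S * (?s + 1)"
      using assms(2) dividend_less_times_div[of S "card X"] by (simp add: algebra_simps)
    also have "\<dots> \<le> S * (2 * ((S ^ 4)\<^sup>2 * card (B (h i))))"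
      using hG[OF that] \<open>0 < ?s\<close> by (intro mult_le_mono2) (simp add: G_def)
    also have "\<dots> = 2 * (S * (S ^ 4)\<^sup>2) * card (B (h i))" by (simp only: mult_ac)
    also have "S * (S ^ 4)\<^sup>2 = S ^ 9" by (simp flip: power_mult power_Suc)
    finally show "card X \<le> 2 * S ^ 9 * card (B (h i))" by simp
  qed
  ultimately show ?thesis
    by (intro exI[of _ "B \<circ> h"] exI[of _ "a \<circ> h"] exI[of _ "b \<circ> h"] exI[of _ "c \<circ> h"]) simp
qed

end

section \<open>Generic projections\<close>

lemma general_position_imp_affine_independent:
  fixes X :: "'a::euclidean_space set"
  assumes X: "finite X" "general_position X" and Q: "Q \<subseteq> X" "card Q \<le> DIM('a) + 1"
  shows "\<not> affine_dependent Q"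
proof -
  have "DIM('a) + 1 \<le> card X" using X unfolding general_position_def by blast
  then obtain S where S: "Q \<subseteq> S" "S \<subseteq> X" "card S = DIM('a) + 1"
    using exists_subset_between[OF Q(2) _ Q(1) X(1)] by blast
  have "\<not> aff_dim S < DIM('a)"
    using aff_lowdim_subset_hyperplane[of S] X(2) S(2,3) unfolding general_position_def by metis
  then have "\<not> affine_dependent S"
    using aff_dim_le_DIM[of S] S(2,3) X(1) finite_subset by (auto simp: affine_independent_iff_card)
  then show ?thesis using S(1) affine_independent_subset by blast
qed

lemma small_set_subset_hyperplane:
  fixes S :: "'a::euclidean_space set"
  assumes "finite S" "card S \<le> DIM('a)"
  shows "\<exists>a b. a \<noteq> 0 \<and> S \<subseteq> {x. a \<bullet> x = b}"
proof -
  have "aff_dim S < DIM('a)" using aff_dim_le_card[OF assms(1)] assms(2) by linarith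
  then show ?thesis using aff_lowdim_subset_hyperplane by blast
qed

definition common_normals :: "'a::euclidean_space set \<Rightarrow> 'a set" where
  "common_normals Q = {z. \<forall>x\<in>Q. \<forall>y\<in>Q. z \<bullet> (x - y) = 0}"

lemma subspace_common_normals: "subspace (common_normals Q)"
  by (auto simp: subspace_def common_normals_def inner_add_left)

lemma dim_common_normals:
  fixes Q :: "'a::euclidean_space set"
  assumes "\<not> affine_dependent Q" "Q \<noteq> {}"
  shows "dim (common_normals Q) + card Q \<le> DIM('a) + 1"
proof -
  obtain q where q: "q \<in> Q" using assms(2) by blast
  let ?D = "(\<lambda>x. x - q) ` Q"
  have "common_normals Q \<subseteq> {y \<in> UNIV. \<forall>x\<in>span ?D. orthogonal x y}"
  proof
    fix z assume "z \<in> common_normals Q"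
    then have "orthogonal z x" if "x \<in> span ?D" for x
      using q by (intro orthogonal_to_span[OF that]) (auto simp: common_normals_def orthogonal_def)
    then show "z \<in> {y \<in> UNIV. \<forall>x\<in>span ?D. orthogonal x y}" by (simp add: orthogonal_commute)
  qed
  then have "dim (common_normals Q) \<le> dim {y \<in> UNIV. \<forall>x\<in>span ?D. orthogonal x y}"
    by (rule dim_subset)
  moreover have "dim {y \<in> UNIV. \<forall>x\<in>span ?D. orthogonal x y} + dim (span ?D) = DIM('a)"
    using dim_subspace_orthogonal_to_vectors[of "span ?D" UNIV] by simp
  moreover have "card Q = dim (span ?D) + 1"
    using affine_independent_card_dim_diffs[OF assms(1) q] by simp
  ultimately show ?thesis by linarith
qed

lemma dim_Un_le_add_card:
  fixes S :: "'a::euclidean_space set"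
  assumes "finite T"
  shows "dim (S \<union> T) \<le> dim S + card T"
  using assms by (induction T) (auto simp: dim_insert)

lemma ex_notin_lowdim_sets:
  fixes \<S> :: "'a::euclidean_space set set"
  assumes "finite \<S>" "\<And>S. S \<in> \<S> \<Longrightarrow> dim S < DIM('a)"
  shows "\<exists>v. \<forall>S\<in>\<S>. v \<notin> S"
proof -
  have "negligible (\<Union>\<S>)" using assms by (intro negligible_Union negligible_lowdim)
  then have "\<Union>\<S> \<noteq> UNIV" using non_negligible_UNIV by metis
  then show ?thesis by blast
qed

lemma ex_independent_modulo:
  fixes \<U> :: "'a::euclidean_space set set"
  assumes "finite B" "finite \<U>" "\<And>U. U \<in> \<U> \<Longrightarrow> subspace U \<and> dim U + card B \<le> DIM('a)"
  shows "\<exists>r. \<forall>U\<in>\<U>. \<forall>c. (\<Sum>b\<in>B. c b *\<^sub>R r b) \<in> U \<longrightarrow> (\<forall>b\<in>B. c b = 0)"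
  using assms(1,3)
proof (induction B)
  case empty
  then show ?case by simp
next
  case (insert b B)
  have "dim U + card B \<le> DIM('a)" if "U \<in> \<U>" for U using insert.prems[OF that] insert.hyps by simp
  then obtain r where r: "\<forall>U\<in>\<U>. \<forall>c. (\<Sum>b\<in>B. c b *\<^sub>R r b) \<in> U \<longrightarrow> (\<forall>b\<in>B. c b = 0)"
    using insert.IH insert.prems by blast
  have lowdim: "dim (span (U \<union> r ` B)) < DIM('a)" if "U \<in> \<U>" for U
  proof -
    have "dim (U \<union> r ` B) \<le> dim U + card (r ` B)"
      using insert.hyps(1) by (intro dim_Un_le_add_card) simp
    also have "\<dots> \<le> dim U + card B" using card_image_le insert.hyps(1) by (intro add_left_mono)
    finally show ?thesis using insert.prems[OF that] insert.hyps by simp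
  qed
  have "\<exists>v. \<forall>S\<in>(\<lambda>U. span (U \<union> r ` B)) ` \<U>. v \<notin> S"
    by (rule ex_notin_lowdim_sets) (use assms(2) lowdim in blast)+
  then obtain v where v: "\<forall>S\<in>(\<lambda>U. span (U \<union> r ` B)) ` \<U>. v \<notin> S" ..
  have "\<forall>b'\<in>insert b B. c b' = 0"
    if U: "U \<in> \<U>" and mem: "(\<Sum>b'\<in>insert b B. c b' *\<^sub>R (r(b := v)) b') \<in> U" for U c
  proof -
    have "(\<Sum>b'\<in>B. c b' *\<^sub>R (r(b := v)) b') = (\<Sum>b'\<in>B. c b' *\<^sub>R r b')"
      using insert.hyps(2) by (intro sum.cong) auto
    then have mem: "c b *\<^sub>R v + (\<Sum>b'\<in>B. c b' *\<^sub>R r b') \<in> U" using mem insert.hyps by simp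
    have "(\<Sum>b'\<in>B. c b' *\<^sub>R r b') \<in> span (U \<union> r ` B)" by (intro span_sum span_scale span_base) auto
    moreover have "c b *\<^sub>R v + (\<Sum>b'\<in>B. c b' *\<^sub>R r b') \<in> span (U \<union> r ` B)"
      using mem by (intro span_base) auto
    ultimately have "c b *\<^sub>R v \<in> span (U \<union> r ` B)" by (simp only: span_add_eq2)
    then have "inverse (c b) *\<^sub>R c b *\<^sub>R v \<in> span (U \<union> r ` B)" by (rule span_scale)
    moreover have "v \<notin> span (U \<union> r ` B)" using v U by blast
    ultimately have "c b = 0" by (cases "c b = 0") auto
    then show ?thesis using r U mem by simp
  qed
  then show ?case by blast
qed

lemma ex_generic_linear_map:
  fixes X :: "'a::euclidean_space set"
  assumes "DIM('b::euclidean_space) \<le> DIM('a)" "finite X" "general_position X"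
  shows "\<exists>f :: 'a \<Rightarrow> 'b. linear f \<and>
    (\<forall>Q\<subseteq>X. card Q = DIM('b) + 1 \<longrightarrow> \<not> (\<exists>a b. a \<noteq> 0 \<and> f ` Q \<subseteq> {x. a \<bullet> x = b}))"
proof -
  let ?\<Q> = "{Q. Q \<subseteq> X \<and> card Q = DIM('b) + 1}"
  have "subspace U \<and> dim U + card (Basis :: 'b set) \<le> DIM('a)" if U: "U \<in> common_normals ` ?\<Q>" for U
  proof -
    obtain Q where Q: "U = common_normals Q" "Q \<subseteq> X" "card Q = DIM('b) + 1" using U by blast
    then have "\<not> affine_dependent Q" "Q \<noteq> {}"
      using general_position_imp_affine_independent[OF assms(2,3)] assms(1) by auto
    then show ?thesis using Q dim_common_normals subspace_common_normals by fastforce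
  qed
  then obtain r :: "'b \<Rightarrow> 'a" where r: "\<forall>U\<in>common_normals ` ?\<Q>. \<forall>c.
      (\<Sum>b\<in>Basis. c b *\<^sub>R r b) \<in> U \<longrightarrow> (\<forall>b\<in>Basis. c b = 0)"
    using ex_independent_modulo[of "Basis :: 'b set" "common_normals ` ?\<Q>"] assms(2) by auto
  define f where "f x = (\<Sum>b\<in>Basis. (r b \<bullet> x) *\<^sub>R b)" for x
  have "linear f"
    by (rule linearI)
      (simp_all add: f_def inner_add_right scaleR_add_left sum.distrib scaleR_sum_right)
  moreover have "a = 0"
    if Q: "Q \<subseteq> X" "card Q = DIM('b) + 1" and hyperplane: "f ` Q \<subseteq> {x. a \<bullet> x = d}" for Q a d
  proof -
    let ?w = "\<Sum>b\<in>Basis. (a \<bullet> b) *\<^sub>R r b"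
    have "a \<bullet> f x = ?w \<bullet> x" for x
      by (simp add: f_def inner_sum_left inner_sum_right mult.commute)
    then have "?w \<in> common_normals Q"
      using hyperplane
      by (auto simp: common_normals_def inner_diff_right simp flip: \<open>\<And>x. a \<bullet> f x = ?w \<bullet> x\<close>)
    then have "\<forall>b\<in>Basis. a \<bullet> b = 0" using r Q by blast
    then show ?thesis by (simp add: euclidean_all_zero_iff)
  qed
  ultimately show ?thesis by blast
qed

theorem ex_generic_projection:
  fixes X :: "'a::euclidean_space set"
  assumes "DIM('b::euclidean_space) \<le> DIM('a)" "finite X" "general_position X"
  shows "\<exists>f :: 'a \<Rightarrow> 'b. linear f \<and> inj_on f X \<and> general_position (f ` X)"
proof -
  obtain f :: "'a \<Rightarrow> 'b" where "linear f" and generic: "\<And>Q a b. Q \<subseteq> X \<Longrightarrow> card Q = DIM('b) + 1 \<Longrightarrow>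
      f ` Q \<subseteq> {x. a \<bullet> x = b} \<Longrightarrow> a = 0"
    using ex_generic_linear_map[OF assms] by metis
  have card_X: "DIM('b) + 1 \<le> card X" using assms unfolding general_position_def by auto
  have inj: "inj_on f X"
  proof (intro inj_onI, rule ccontr)
    fix x y assume xy: "x \<in> X" "y \<in> X" "f x = f y" "x \<noteq> y"
    then have "card {x, y} \<le> DIM('b) + 1" using DIM_positive[where 'a = 'b] by simp
    then obtain Q where Q: "{x, y} \<subseteq> Q" "Q \<subseteq> X" "card Q = DIM('b) + 1"
      using exists_subset_between[OF _ card_X _ assms(2), of "{x, y}"] xy(1,2) by auto
    have finQ: "finite Q" using Q(2) assms(2) finite_subset by blast
    have "f x \<in> f ` (Q - {x})" unfolding xy(3) using Q(1) xy(4) by (intro imageI) auto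
    then have "f ` Q = f ` (Q - {x})" by blast
    then have "card (f ` Q) \<le> DIM('b)"
      using card_image_le[of "Q - {x}" f] Q finQ by simp
    then show False using small_set_subset_hyperplane[of "f ` Q"] finQ generic[OF Q(2,3)] by auto
  qed
  have "general_position (f ` X)"
    unfolding general_position_def
  proof (intro conjI impI notI)
    show "DIM('b) + 1 \<le> card (f ` X)" using card_X inj by (simp add: card_image)
    assume "\<exists>S a b. S \<subseteq> f ` X \<and> card S = DIM('b) + 1 \<and> a \<noteq> 0 \<and> S \<subseteq> {x. a \<bullet> x = b}"
    then obtain S a b where S: "S \<subseteq> f ` X" "card S = DIM('b) + 1" "a \<noteq> 0" "S \<subseteq> {x. a \<bullet> x = b}"
      by blast
    then obtain Q where "Q \<subseteq> X" "inj_on f Q" "S = f ` Q" by (meson subset_image_inj)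
    then show False using S(2-4) generic by (simp add: card_image)
  qed
  then show ?thesis using \<open>linear f\<close> inj by blast
qed

section \<open>Families in convex position\<close>

lemma convex_positionI:
  assumes "finite P" "\<And>x. x \<in> P \<Longrightarrow> x \<notin> convex hull (P - {x})"
  shows "convex_position P"
proof -
  have "P = {x. x extreme_point_of (convex hull P)}"
    using extreme_point_of_convex_hull_convex_independent[OF finite_imp_compact[OF assms(1)] assms(2)]
    by auto
  moreover have "polytope (convex hull P)" using assms(1) unfolding polytope_def by blast
  ultimately show ?thesis unfolding convex_position_def by blast
qed

lemma convex_positionD:
  assumes "convex_position P" "x \<in> P"
  shows "x \<notin> convex hull (P - {x})"
proof -
  obtain K where K: "polytope K" "P = {v. v extreme_point_of K}"
    using assms(1) unfolding convex_position_def by blast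
  then have "convex (K - {x})"
    using assms(2) extreme_point_of_stillconvex polytope_imp_convex by blast
  moreover have "P - {x} \<subseteq> K - {x}" using K(2) by (auto simp: extreme_point_of_def)
  ultimately have "convex hull (P - {x}) \<subseteq> K - {x}" by (intro hull_minimal)
  then show ?thesis by blast
qed

lemma family_convex_position_mono:
  assumes "family_convex_position I X" "J \<subseteq> I" "\<And>i. i \<in> J \<Longrightarrow> Y i \<subseteq> X i"
  shows "family_convex_position J Y"
  unfolding family_convex_position_def
proof
  fix i assume i: "i \<in> J"
  have "convex hull (Y i) \<subseteq> convex hull (X i)" using assms(3)[OF i] by (rule hull_mono)
  moreover have "convex hull (\<Union>j\<in>J - {i}. Y j) \<subseteq> convex hull (\<Union>j\<in>I - {i}. X j)"
    using assms(2,3) by (intro hull_mono) blast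
  moreover have "convex hull (X i) \<inter> convex hull (\<Union>j\<in>I - {i}. X j) = {}"
    using assms(1,2) i unfolding family_convex_position_def by blast
  ultimately show "convex hull (Y i) \<inter> convex hull (\<Union>j\<in>J - {i}. Y j) = {}" by blast
qed

lemma family_convex_position_linear_image:
  assumes "linear f" "family_convex_position I (\<lambda>i. f ` X i)"
  shows "family_convex_position I X"
  unfolding family_convex_position_def
proof (intro ballI equals0I)
  fix i z assume i: "i \<in> I" and z: "z \<in> convex hull X i \<inter> convex hull (\<Union>j\<in>I - {i}. X j)"
  have "f z \<in> f ` (convex hull X i)" "f z \<in> f ` (convex hull (\<Union>j\<in>I - {i}. X j))" using z by auto
  then have "f z \<in> convex hull (f ` X i)" "f z \<in> convex hull (\<Union>j\<in>I - {i}. f ` X j)"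
    using assms(1) by (simp_all add: convex_hull_linear_image image_UN)
  then show False using assms(2) i unfolding family_convex_position_def by blast
qed

lemma family_convex_position_singletons:
  assumes "convex_position P" "inj_on x I" "x ` I \<subseteq> P"
  shows "family_convex_position I (\<lambda>i. {x i})"
  unfolding family_convex_position_def
proof
  fix i assume i: "i \<in> I"
  have "(\<Union>j\<in>I - {i}. {x j}) \<subseteq> P - {x i}" using assms(2,3) i by (auto dest: inj_onD)
  then have "convex hull (\<Union>j\<in>I - {i}. {x j}) \<subseteq> convex hull (P - {x i})" by (rule hull_mono)
  moreover have "x i \<notin> convex hull (P - {x i})"
    using assms(3) i by (intro convex_positionD[OF assms(1)]) blast
  ultimately have "x i \<notin> convex hull (\<Union>j\<in>I - {i}. {x j})" by blast
  then show "convex hull {x i} \<inter> convex hull (\<Union>j\<in>I - {i}. {x j}) = {}" by simp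
qed

lemma family_convex_position_transversal:
  assumes "family_convex_position I B" "finite I" "\<And>i. i \<in> I \<Longrightarrow> x i \<in> B i"
  shows "inj_on x I" and "convex_position (x ` I)"
proof -
  have outside: "x i \<notin> convex hull (x ` (I - {i}))" if i: "i \<in> I" for i
  proof -
    have "family_convex_position I (\<lambda>i. {x i})"
      using assms(3) by (intro family_convex_position_mono[OF assms(1)]) auto
    then show ?thesis using i by (simp add: family_convex_position_def UNION_singleton_eq_range)
  qed
  show inj: "inj_on x I"
  proof (intro inj_onI, rule ccontr)
    fix i j assume "i \<in> I" "j \<in> I" "x i = x j" "i \<noteq> j"
    then have "x i \<in> x ` (I - {i})" by auto
    then show False using outside[OF \<open>i \<in> I\<close>] hull_inc by metis
  qed
  show "convex_position (x ` I)"
  proof (rule convex_positionI)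
    fix y assume "y \<in> x ` I"
    then obtain i where i: "i \<in> I" "y = x i" by blast
    then have "x ` I - {y} = x ` (I - {i})" using inj by (auto simp: inj_on_def)
    then show "y \<notin> convex hull (x ` I - {y})" using outside i by simp
  qed (use assms(2) in simp)
qed

definition has_convex_family :: "'a::euclidean_space set \<Rightarrow> nat \<Rightarrow> real \<Rightarrow> bool" where
  "has_convex_family X n \<epsilon> \<longleftrightarrow> (\<exists>Y. (\<forall>i\<in>{1..n}. Y i \<subseteq> X) \<and> family_convex_position {1..n} Y \<and>
     (\<forall>i\<in>{1..n}. \<epsilon> * real (card X) \<le> real (card (Y i))))"

lemma has_convex_family_mono:
  assumes "has_convex_family X n \<epsilon>" "m \<le> n"
  shows "has_convex_family X m \<epsilon>"
proof -
  have "{1..m} \<subseteq> {1..n}" using assms(2) by auto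
  then show ?thesis
    using assms(1) family_convex_position_mono[of "{1..n}" _ "{1..m}"] unfolding has_convex_family_def
    by blast
qed

lemma has_convex_family_linear_image:
  assumes "linear f" "inj_on f X" "has_convex_family (f ` X) n \<epsilon>"
  shows "has_convex_family X n \<epsilon>"
proof -
  obtain B where B: "\<And>i. i \<in> {1..n} \<Longrightarrow> B i \<subseteq> f ` X" "family_convex_position {1..n} B"
    "\<And>i. i \<in> {1..n} \<Longrightarrow> \<epsilon> * real (card (f ` X)) \<le> real (card (B i))"
    using assms(3) unfolding has_convex_family_def by blast
  define Y where "Y i = X \<inter> f -` B i" for i
  have image: "f ` Y i = B i" if "i \<in> {1..n}" for i using B(1)[OF that] by (auto simp: Y_def)
  have "family_convex_position {1..n} (\<lambda>i. f ` Y i)"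
    using image by (intro family_convex_position_mono[OF B(2)]) auto
  then have "family_convex_position {1..n} Y"
    by (rule family_convex_position_linear_image[OF assms(1)])
  moreover have "\<epsilon> * real (card X) \<le> real (card (Y i))" if i: "i \<in> {1..n}" for i
  proof -
    have "inj_on f (Y i)" using assms(2) by (auto simp: Y_def intro: inj_on_subset)
    then have "card (Y i) = card (B i)" using image[OF i] card_image by metis
    then show ?thesis using B(3)[OF i] assms(2) by (simp add: card_image)
  qed
  moreover have "Y i \<subseteq> X" for i by (simp add: Y_def)
  ultimately show ?thesis unfolding has_convex_family_def by blast
qed

lemma has_convex_family_imp_convex_position:
  assumes "has_convex_family X n \<epsilon>" "0 < \<epsilon>" "finite X" "X \<noteq> {}"
  shows "\<exists>P\<subseteq>X. card P = n \<and> convex_position P"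
proof -
  obtain Y where Y: "\<And>i. i \<in> {1..n} \<Longrightarrow> Y i \<subseteq> X" "family_convex_position {1..n} Y"
    "\<And>i. i \<in> {1..n} \<Longrightarrow> \<epsilon> * real (card X) \<le> real (card (Y i))"
    using assms(1) unfolding has_convex_family_def by blast
  have "0 < \<epsilon> * real (card X)" using assms(2-4) by (simp add: card_gt_0_iff)
  then have "Y i \<noteq> {}" if "i \<in> {1..n}" for i using Y(3)[OF that] by auto
  then have "\<forall>i\<in>{1..n}. \<exists>y. y \<in> Y i" by (simp add: ex_in_conv)
  then obtain x where x: "\<And>i. i \<in> {1..n} \<Longrightarrow> x i \<in> Y i" by metis
  have "inj_on x {1..n}" "convex_position (x ` {1..n})"
    using family_convex_position_transversal[OF Y(2) _ x] by auto
  moreover have "x ` {1..n} \<subseteq> X" using x Y(1) by blast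
  ultimately show ?thesis by (metis card_atLeastAtMost card_image diff_Suc_1)
qed

lemma convex_position_imp_has_convex_family:
  assumes "convex_position P" "P \<subseteq> X" "finite X" "n \<le> card P" "\<epsilon> * real (card X) \<le> 1"
  shows "has_convex_family X n \<epsilon>"
proof -
  obtain P' where P': "P' \<subseteq> P" "card P' = n" using assms(4) by (metis obtain_subset_with_card_n)
  then have "finite P'" using assms(2,3) finite_subset by metis
  then obtain x where x: "bij_betw x {1..n} P'"
    using finite_same_card_bij[of "{1..n}" P'] P'(2) by auto
  have "family_convex_position {1..n} (\<lambda>i. {x i})"
    using x P'(1)
    by (intro family_convex_position_singletons[OF assms(1)]) (auto simp: bij_betw_def)
  moreover have "{x i} \<subseteq> X" if "i \<in> {1..n}" for i
    using bij_betwE[OF x] P'(1) assms(2) that by blast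
  ultimately show ?thesis
    unfolding has_convex_family_def using assms(5) by (intro exI[of _ "\<lambda>i. {x i}"]) simp
qed

definition positive_fraction :: "'a::euclidean_space itself \<Rightarrow> nat \<Rightarrow> nat \<Rightarrow> bool" where
  "positive_fraction _ n t \<longleftrightarrow> (\<forall>X::'a set. finite X \<longrightarrow> general_position X \<longrightarrow> 2 ^ t \<le> card X \<longrightarrow>
     has_convex_family X n (1 / 2 ^ t))"

lemma positive_fraction_mono:
  "positive_fraction TYPE('a::euclidean_space) n t \<Longrightarrow> m \<le> n \<Longrightarrow> positive_fraction TYPE('a) m t"
  unfolding positive_fraction_def using has_convex_family_mono by blast

lemma general_position_subset:
  fixes X :: "'a::euclidean_space set"
  assumes "general_position X" "Y \<subseteq> X" "DIM('a) + 1 \<le> card Y"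
  shows "general_position Y"
  using assms unfolding general_position_def by (meson order_trans)

lemma ES_imp_convex_position:
  fixes X :: "'a::euclidean_space set"
  assumes "positive_fraction TYPE('a) n t" "finite X" "general_position X" "ES TYPE('a) n \<le> card X"
  shows "\<exists>P\<subseteq>X. card P = n \<and> convex_position P"
proof -
  let ?forces = "\<lambda>N. N \<ge> DIM('a) + 1 \<and> (\<forall>X::'a set. finite X \<and> card X = N \<and> general_position X \<longrightarrow>
    (\<exists>P\<subseteq>X. card P = n \<and> convex_position P))"
  have "?forces (DIM('a) + 1 + 2 ^ t)"
  proof (intro conjI allI impI)
    fix X :: "'a set" assume X: "finite X \<and> card X = DIM('a) + 1 + 2 ^ t \<and> general_position X"
    then have "has_convex_family X n (1 / 2 ^ t)"
      using assms(1) unfolding positive_fraction_def by simp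
    then show "\<exists>P\<subseteq>X. card P = n \<and> convex_position P"
      using X by (intro has_convex_family_imp_convex_position[of X n "1 / 2 ^ t"]) auto
  qed simp
  then have ES: "?forces (ES TYPE('a) n)" unfolding ES_def by (rule LeastI)
  obtain Y where Y: "Y \<subseteq> X" "card Y = ES TYPE('a) n"
    using assms(4) by (meson obtain_subset_with_card_n)
  moreover have "general_position Y" using general_position_subset[OF assms(3) Y(1)] ES Y(2) by simp
  moreover have "finite Y" using Y(1) assms(2) finite_subset by blast
  ultimately show ?thesis using ES by (meson subset_trans)
qed

section \<open>Positive fractions in three dimensions\<close>

definition orient3 :: "real ^ 3 \<Rightarrow> real ^ 3 \<Rightarrow> real ^ 3 \<Rightarrow> real ^ 3 \<Rightarrow> real" where
  "orient3 a b c d = cross3 (b - a) (c - a) \<bullet> (d - a)"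

lemma cross3_inner_pluecker:
  "(cross3 u c \<bullet> d) * (cross3 u e \<bullet> f) - (cross3 u c \<bullet> e) * (cross3 u d \<bullet> f) +
    (cross3 u c \<bullet> f) * (cross3 u d \<bullet> e) = 0"
  unfolding inner_vec_def sum_3 cross_components inner_real_def by algebra

interpretation orient3: chirotope orient3
proof
  show "orient3 b a c d = - orient3 a b c d" "orient3 a c b d = - orient3 a b c d"
    "orient3 a b d c = - orient3 a b c d" for a b c d
    unfolding orient3_def inner_vec_def sum_3 cross_components inner_real_def vector_minus_component
    by algebra+
  show "orient3 a b c d * orient3 a b e f - orient3 a b c e * orient3 a b d f +
      orient3 a b c f * orient3 a b d e = 0"
    for a b c d e f unfolding orient3_def by (rule cross3_inner_pluecker)
qed

lemma orient3_eq_0_imp_coplanar: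
  assumes "orient3 a b c d = 0"
  shows "\<exists>n. n \<noteq> 0 \<and> {a, b, c, d} \<subseteq> {x. n \<bullet> x = n \<bullet> a}"
proof -
  define A :: "real ^ 3 ^ 3" where "A = vector [d - a, b - a, c - a]"
  have "det A = 0"
    using assms dot_cross_det[of "d - a" "b - a" "c - a"]
    by (simp add: A_def orient3_def inner_commute)
  then have "\<not> invertible A" by (simp add: invertible_det_nz)
  then obtain n where n: "A *v n = 0" "n \<noteq> 0"
    using invertible_left_inverse matrix_left_invertible_ker by blast
  have "(A *v n) $ i = A $ i \<bullet> n" for i by (simp add: matrix_mult_dot)
  then have "A $ 1 \<bullet> n = 0" "A $ 2 \<bullet> n = 0" "A $ 3 \<bullet> n = 0" using n(1) by auto
  then have "n \<bullet> d = n \<bullet> a" "n \<bullet> b = n \<bullet> a" "n \<bullet> c = n \<bullet> a"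
    by (simp_all add: A_def inner_commute[of _ n] inner_diff_right)
  then show ?thesis using n(2) by blast
qed

lemma general_position_imp_nondegenerate:
  assumes "general_position X"
  shows "orient3.nondegenerate X"
  unfolding orient3.nondegenerate_def
proof (intro allI impI)
  fix a b c d assume abcd: "{a, b, c, d} \<subseteq> X" "distinct [a, b, c, d]"
  then have "card {a, b, c, d} = DIM(real ^ 3) + 1" by auto
  then have "\<not> (\<exists>n. n \<noteq> 0 \<and> {a, b, c, d} \<subseteq> {x. n \<bullet> x = n \<bullet> a})"
    using assms abcd(1) unfolding general_position_def by meson
  then show "orient3 a b c d \<noteq> 0" using orient3_eq_0_imp_coplanar by blast
qed

lemma separating_planes_imp_family_convex_position:
  assumes "orient3.separating_planes I a b c B"
  shows "family_convex_position I B"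
  unfolding family_convex_position_def
proof
  fix i assume i: "i \<in> I"
  let ?f = "orient3 (a i) (b i) (c i)" and ?n = "cross3 (b i - a i) (c i - a i)"
  have "convex {x. 0 < ?f x}" "convex {x. ?f x < 0}"
    using convex_halfspace_gt[of "?n \<bullet> a i" ?n] convex_halfspace_lt[of ?n "?n \<bullet> a i"]
    by (simp_all add: orient3_def inner_diff_right)
  then have "convex hull (B i) \<subseteq> {x. 0 < ?f x}" "convex hull (\<Union>j\<in>I - {i}. B j) \<subseteq> {x. ?f x < 0}"
    using assms i unfolding orient3.separating_planes_def by (intro hull_minimal; blast)+
  then show "convex hull (B i) \<inter> convex hull (\<Union>j\<in>I - {i}. B j) = {}" by force
qed

lemma positive_fraction_if_cut_off_points:
  assumes "\<And>Y. finite Y \<Longrightarrow> orient3.nondegenerate Y \<Longrightarrow> card Y = 2 ^ \<sigma> \<Longrightarrow> orient3.cut_off_points Y (2 * n)"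
  shows "positive_fraction TYPE(real ^ 3) n (9 * \<sigma> + 1)"
  unfolding positive_fraction_def
proof (intro allI impI)
  fix X :: "(real ^ 3) set"
  assume X: "finite X" "general_position X" "2 ^ (9 * \<sigma> + 1) \<le> card X"
  have "(2::nat) ^ \<sigma> \<le> 2 ^ (9 * \<sigma> + 1)" by (intro power_increasing) auto
  then have "2 ^ \<sigma> \<le> card X" using X(3) by linarith
  moreover have "\<forall>Y\<subseteq>X. card Y = 2 ^ \<sigma> \<longrightarrow> orient3.cut_off_points Y (2 * n)"
    using assms X(1) finite_subset
      orient3.nondegenerate_subset[OF general_position_imp_nondegenerate[OF X(2)]] by blast
  ultimately obtain B a b c where planes: "orient3.separating_planes {1..n} a b c B"
    and B: "\<forall>i\<in>{1..n}. B i \<subseteq> X \<and> card X \<le> 2 * (2 ^ \<sigma>) ^ 9 * card (B i)"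
    using orient3.positive_fraction_cut_off[OF X(1), of "2 ^ \<sigma>" n] by auto
  have "1 / 2 ^ (9 * \<sigma> + 1) * real (card X) \<le> real (card (B i))" if "i \<in> {1..n}" for i
  proof -
    have "2 * (2 ^ \<sigma>) ^ 9 = (2::nat) ^ (9 * \<sigma> + 1)" by (simp add: mult.commute flip: power_mult)
    then have "card X \<le> 2 ^ (9 * \<sigma> + 1) * card (B i)" using B that by metis
    then have "real (card X) \<le> real (2 ^ (9 * \<sigma> + 1) * card (B i))" by (simp only: of_nat_le_iff)
    then show ?thesis by (simp add: field_simps)
  qed
  then show "has_convex_family X n (1 / 2 ^ (9 * \<sigma> + 1))"
    unfolding has_convex_family_def
    using separating_planes_imp_family_convex_position[OF planes] B by blast
qed

lemma positive_fraction_eventually: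
  assumes "0 < \<delta>"
  shows "\<forall>\<^sub>F n in sequentially. \<exists>t. real t \<le> \<delta> * real n \<and> positive_fraction TYPE(real ^ 3) n t"
proof -
  define \<eta> where "\<eta> = \<delta> / 36"
  have "0 < \<eta>" using assms by (simp add: \<eta>_def)
  have "filterlim (\<lambda>n. 2 * n) sequentially (sequentially :: nat filter)" by real_asymp
  then have "\<forall>\<^sub>F n in sequentially. \<forall>Y. finite Y \<longrightarrow> orient3.nondegenerate Y \<longrightarrow>
      2 powr (\<eta> * real (2 * n)) \<le> real (card Y) \<longrightarrow> orient3.cut_off_points Y (2 * n)"
    using orient3.cut_off_points_subexponential[OF \<open>0 < \<eta>\<close>]
    by (rule eventually_compose_filterlim[rotated])
  moreover have "\<forall>\<^sub>F n in sequentially. \<delta> / 2 * real n + 10 \<le> \<delta> * real n" using assms by real_asymp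
  ultimately show ?thesis
  proof eventually_elim
    case (elim n)
    define \<sigma> where "\<sigma> = nat \<lceil>\<eta> * real (2 * n)\<rceil>"
    have \<sigma>: "\<eta> * real (2 * n) \<le> real \<sigma>" "real \<sigma> < \<eta> * real (2 * n) + 1"
      using \<open>0 < \<eta>\<close> unfolding \<sigma>_def by (auto simp: of_nat_nat ceiling_less_iff) linarith
    have "orient3.cut_off_points Y (2 * n)"
      if "finite Y" "orient3.nondegenerate Y" "card Y = 2 ^ \<sigma>" for Y
    proof -
      have "2 powr (\<eta> * real (2 * n)) \<le> 2 powr real \<sigma>" using \<sigma>(1) by (intro powr_mono) auto
      then show ?thesis using elim(1) that by (simp add: powr_realpow)
    qed
    then have "positive_fraction TYPE(real ^ 3) n (9 * \<sigma> + 1)"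
      by (rule positive_fraction_if_cut_off_points)
    moreover have "real (9 * \<sigma> + 1) \<le> \<delta> * real n" using \<sigma>(2) elim(2) by (simp add: \<eta>_def)
    ultimately show ?case by blast
  qed
qed

lemma ex_positive_fraction: "\<exists>t. positive_fraction TYPE(real ^ 3) n t"
proof -
  obtain N where "\<forall>m\<ge>N. \<exists>t. real t \<le> 1 * real m \<and> positive_fraction TYPE(real ^ 3) m t"
    using positive_fraction_eventually[of 1] unfolding eventually_sequentially by auto
  then obtain t where "positive_fraction TYPE(real ^ 3) (max n N) t" using max.cobounded2 by blast
  then show ?thesis using positive_fraction_mono[OF _ max.cobounded1] by blast
qed

definition fraction_exponent :: "nat \<Rightarrow> nat" where
  "fraction_exponent n = (LEAST t. positive_fraction TYPE(real ^ 3) n t)"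

lemma positive_fraction_exponent: "positive_fraction TYPE(real ^ 3) n (fraction_exponent n)"
  unfolding fraction_exponent_def using ex_positive_fraction by (rule LeastI_ex)

lemma fraction_exponent_smallo: "(\<lambda>n. real (fraction_exponent n)) \<in> o(\<lambda>n. real n)"
proof (rule landau_o.smallI)
  fix c :: real assume "c > 0"
  from positive_fraction_eventually[OF this]
  show "\<forall>\<^sub>F n in sequentially. norm (real (fraction_exponent n)) \<le> c * norm (real n)"
  proof eventually_elim
    case (elim n)
    then obtain t where t: "real t \<le> c * real n" "positive_fraction TYPE(real ^ 3) n t" by blast
    have "fraction_exponent n \<le> t" unfolding fraction_exponent_def using t(2) by (rule Least_le)
    then show ?case using t(1) by simp
  qed
qed

lemma has_convex_family_fraction_exponent:
  fixes X :: "(real ^ 3) set"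
  assumes X: "finite X" "general_position X" and "ES TYPE(real ^ 3) m \<le> card X" "n \<le> m"
  shows "has_convex_family X n (1 / 2 ^ fraction_exponent n)"
proof (cases "2 ^ fraction_exponent n \<le> card X")
  case True
  then show ?thesis using positive_fraction_exponent X unfolding positive_fraction_def by blast
next
  case False
  obtain P where P: "P \<subseteq> X" "card P = m" "convex_position P"
    using ES_imp_convex_position[OF positive_fraction_exponent X assms(3)] by blast
  have "real (card X) \<le> 2 ^ fraction_exponent n"
    using False by (metis less_imp_le not_le of_nat_less_numeral_power_cancel_iff)
  then show ?thesis
    using P X(1) assms(4) by (intro convex_position_imp_has_convex_family[of P]) simp_all
qed

theorem theorem1p3:
  assumes "CARD('d::finite) \<ge> 3"
  shows "\<exists>\<epsilon>::nat \<Rightarrow> real.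
    (\<forall>n\<ge>3. \<epsilon> n > 0) \<and>
    (\<lambda>n. log 2 (1 / \<epsilon> n)) \<in> o(\<lambda>n. real n) \<and>
    (\<forall>n\<ge>3. \<forall>\<X>::(real ^ 'd) set.
       finite \<X> \<and> general_position \<X> \<and> card \<X> \<ge> ES TYPE(real ^ 3) (8 * n) \<longrightarrow>
       (\<exists>X::nat \<Rightarrow> (real ^ 'd) set.
          (\<forall>i\<in>{1..n}. X i \<subseteq> \<X>) \<and>
          family_convex_position {1..n} X \<and>
          (\<forall>i\<in>{1..n}. real (card (X i)) \<ge> \<epsilon> n * real (card \<X>))))"
proof -
  define \<epsilon> :: "nat \<Rightarrow> real" where "\<epsilon> n = 1 / 2 ^ fraction_exponent n" for n
  have "(\<lambda>n. log 2 (1 / \<epsilon> n)) = (\<lambda>n. real (fraction_exponent n))"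
    by (simp add: \<epsilon>_def log_nat_power)
  then have "(\<lambda>n. log 2 (1 / \<epsilon> n)) \<in> o(\<lambda>n. real n)" using fraction_exponent_smallo by simp
  moreover have "has_convex_family \<X> n (\<epsilon> n)"
    if X: "finite \<X>" "general_position \<X>" "ES TYPE(real ^ 3) (8 * n) \<le> card \<X>"
    for n and \<X> :: "(real ^ 'd) set"
  proof -
    obtain f :: "real ^ 'd \<Rightarrow> real ^ 3" where f: "linear f" "inj_on f \<X>" "general_position (f ` \<X>)"
      using ex_generic_projection[of \<X>, where 'b = "real ^ 3"] assms X(1,2) by auto
    then have "has_convex_family (f ` \<X>) n (\<epsilon> n)"
      unfolding \<epsilon>_def using X
      by (intro has_convex_family_fraction_exponent[of _ "8 * n"]) (auto simp: card_image)
    then show ?thesis by (rule has_convex_family_linear_image[OF f(1,2)])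
  qed
  moreover have "\<forall>n\<ge>3. \<epsilon> n > 0" by (simp add: \<epsilon>_def)
  ultimately show ?thesis unfolding has_convex_family_def by blast
qed

end
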